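(* For every integer $\nu\ge 1$ there exists a constant $C(\nu)$ such that, for every prime $p$, every non-principal multiplicative character $\chi$ modulo $p$, all positive integers $A,B,C,D$ satisfying $ABC<p$ and $D<p$, every set $\mathcal D\subseteq\mathbb F_p^*$ of cardinality $\sharp\mathcal D=D$, and all complex weights $\boldsymbol\alpha=(\alpha_d)_{d\in\mathcal D}$ satisfying $|\alpha_d|\le 1$ for $d\in\mathcal D$, one has $$T_\chi(A,B,C,\mathcal D;\boldsymbol\alpha)\le C(\nu)\,ABCD\left(\left(\frac{p}{ABC}\right)^{1/(2\nu)}D^{-1/2}+\left(\frac{p^{1/2}}{ABC}\right)^{1/(2\nu)}\right)(\log p)^{4/\nu},$$ where $$T_\chi(A,B,C,\mathcal D;\boldsymbol\alpha)=\sum_{1\le a\le A}\ \sum_{1\le b\le B}\ \sum_{1\le c\le C}\left|\sum_{d\in\mathcal D}\alpha_d\,\chi(ab-cd)\right|.$$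
   Context: $\mathbb F_p^*$ is identified with the set of integers $\{1,2,\ldots,p-1\}$. A multiplicative character $\chi$ modulo $p$ is viewed as a function on $\mathbb Z$ (Dirichlet character), with $\chi(n)=0$ when $p\mid n$. *)

theory Defs
  imports Complex_Main "HOL-Computational_Algebra.Primes" "HOL-Number_Theory.Cong"
begin

text \<open>Dirichlet characters modulo \<open>m\<close> as functions on the integers, i.e. complex characters of the
  unit group modulo \<open>m\<close> extended by zero. That the nonzero values are roots of unity follows from
  multiplicativity and periodicity.\<close>

definition dirichlet_char :: "nat \<Rightarrow> (int \<Rightarrow> complex) \<Rightarrow> bool" where
  "dirichlet_char m chi \<longleftrightarrow>
     (\<forall>k l. chi (k * l) = chi k * chi l) \<and>
     (\<forall>k l. [k = l] (mod int m) \<longrightarrow> chi k = chi l) \<and>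
     (\<forall>k. chi k = 0 \<longleftrightarrow> \<not> coprime k (int m))"

definition principal_char :: "nat \<Rightarrow> int \<Rightarrow> complex" where
  "principal_char m = (\<lambda>k. if coprime k (int m) then 1 else 0)"

definition T_sum ::
  "(int \<Rightarrow> complex) \<Rightarrow> nat \<Rightarrow> nat \<Rightarrow> nat \<Rightarrow> nat set \<Rightarrow> (nat \<Rightarrow> complex) \<Rightarrow> real" where
  "T_sum chi A B C \<D> \<alpha> =
     (\<Sum>a=1..A. \<Sum>b=1..B. \<Sum>c=1..C.
        cmod (\<Sum>d\<in>\<D>. \<alpha> d * chi (int a * int b - int c * int d)))"

end

theory Submission
  imports Defs "Berlekamp_Zassenhaus.Distinct_Degree_Factorization"
    "HOL-Analysis.Kronecker_Approximation_Theorem" "HOL-Analysis.Harmonic_Numbers"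
    "HOL-Computational_Algebra.Polynomial_FPS"
begin

text \<open>
  For \<open>1 \<le> c \<le> C\<close>, the absolute value of the inner sum depends only on the residue \<open>x\<close> of \<open>a * b / c\<close>
  modulo \<open>p\<close>. Let \<open>r x\<close> be the number of triples \<open>(a, b, c)\<close> with residue \<open>x\<close>, and let \<open>S x\<close> be the sum
  of \<open>\<alpha> d * chi (d - x)\<close> over \<open>d\<close>. Hoelder's inequality (lemma \<open>sum_over_map_power_le\<close>) bounds \<open>T ^ (2 * \<nu>)\<close>, where
  \<open>T = (\<Sum>x. r x * \<bar>S x\<bar>)\<close>, by the product of \<open>(\<Sum>x. r x) ^ (2 * \<nu> - 2) = (A * B * C) ^ (2 * \<nu> - 2)\<close>, of \<open>\<Sum>x. r x ^ 2\<close>, and of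
  \<open>\<Sum>x. \<bar>S x\<bar> ^ (2 * \<nu>)\<close>.

  The second factor counts the solutions of \<open>a * b * c' = a' * b' * c\<close>: as \<open>A * B * C < p\<close>, the congruence is an
  equality. Refining the two factorisations to a \<open>3 \<times> 3\<close> matrix of divisors shows that there are at most
  \<open>A * B * C\<close> times the sixth power of a harmonic sum (lemma \<open>card_multiplicative_energy_le\<close>), hence
  \<open>O(A * B * C * (ln p) ^ 6)\<close> solutions.

  The third factor is \<open>O(p * D ^ \<nu> + sqrt p * D ^ (2 * \<nu>))\<close> (lemma \<open>character_moment_bound\<close>). After expanding the power, one
  meets complete sums of \<open>chi\<close> over products of \<open>2 * \<nu>\<close> linear factors, half of them conjugated. If a root occurs exactly
  once, such a sum is \<open>O(sqrt p)\<close> by Weil's theorem; otherwise there are at most \<open>\<nu>\<close> distinct roots, and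
  only \<open>O(D ^ \<nu>)\<close> tuples of this kind.

  Most of the work goes into Weil's bound (lemma \<open>weil_bound\<close>). For a monic polynomial \<open>g\<close> over \<open>F\<^sub>p\<close> let \<open>F g\<close> be \<open>chi\<close>
  of the product of the values of \<open>g\<close> at the prescribed roots. The generating function of the sums of
  \<open>F\<close> over monic polynomials of degree \<open>n\<close> is a polynomial \<open>L\<close> of degree less than the number of distinct
  roots, and its first coefficient is the character sum. Unique factorisation relates the coefficients by
  Newton's identities to sums over prime powers, which are character sums over the extensions of \<open>F\<^sub>p\<close>. For
  these sums it is enough to know the order of magnitude as the degree grows, with any dependence of
  the constant on \<open>p\<close>; this determines the size of the reciprocal roots of \<open>L\<close>. The estimate comes from
  Stepanov's method (lemma \<open>stepanov_bound\<close>) in Bombieri's form, in which Frobenius powers replace derivatives.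
  The root of multiplicity one makes the independence of the auxiliary functions obvious. Extension fields
  are not constructed: an element of an extension is represented by its minimal polynomial \<open>\<pi>\<close>, and
  identities at this element are congruences modulo \<open>\<pi>\<close>.
\<close>

section \<open>Power sums and the Newton recurrence\<close>

text \<open>
  By simultaneous Diophantine approximation there are arbitrarily large exponents \<open>k\<close> for which
  all the numbers \<open>u i ^ k\<close> have argument close to \<open>0\<close>. For such \<open>k\<close> there is no cancellation in
  the power sum, so it would be unbounded if one of the \<open>u i\<close> lay outside the unit disc.
\<close>
lemma bounded_power_sums_imp_norm_le_1:
  fixes u :: "nat \<Rightarrow> complex" and n :: nat and C :: real
  assumes bound: "\<And>k. k \<ge> 1 \<Longrightarrow> cmod (\<Sum>i<n. u i ^ k) \<le> C"
  assumes "i < n"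
  shows "cmod (u i) \<le> 1"
proof (rule ccontr)
  assume "\<not> cmod (u i) \<le> 1"
  hence gt: "cmod (u i) > 1" by simp
  obtain M0 where M0: "2 * C < cmod (u i) ^ M0"
    using real_arch_pow[OF gt] by blast
  define M where "M = Suc M0"
  have M: "2 * C < cmod (u i) ^ M"
    using M0 gt power_increasing[of M0 M "cmod (u i)"] by (simp add: M_def del: power_Suc)
  \<comment> \<open>The factor \<open>M\<close> forces the exponent \<open>k\<close> found below to be at least \<open>M\<close>.\<close>
  define \<theta> where "\<theta> = (\<lambda>i. real M * (Arg (u i) / (2 * pi)))"
  obtain q p where q: "0 < q" and qp: "\<And>i. i < n \<Longrightarrow> \<bar>of_int q * \<theta> i - of_int (p i)\<bar> < 1 / real 8"
    by (rule Dirichlet_approx_simult[of 8 n \<theta>]) auto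
  define k where "k = M * nat q"
  have "nat q \<ge> 1" using q by linarith
  hence k1: "k \<ge> M" by (simp add: k_def)
  have Re: "Re (u j ^ k) \<ge> cmod (u j) ^ k / 2" if j: "j < n" for j
  proof -
    define \<delta> where "\<delta> = of_int q * \<theta> j - of_int (p j)"
    have \<delta>: "\<bar>\<delta>\<bar> < 1 / 8" using qp[OF j] by (simp add: \<delta>_def)
    have ang: "real k * Arg (u j) = 2 * pi * of_int (p j) + 2 * pi * \<delta>"
      using q by (simp add: \<delta>_def \<theta>_def k_def field_simps)
    have "rcis (cmod (u j)) (Arg (u j)) ^ k = rcis (cmod (u j) ^ k) (real k * Arg (u j))"
      by (rule DeMoivre2)
    hence "u j ^ k = rcis (cmod (u j) ^ k) (real k * Arg (u j))"
      by (simp only: rcis_cmod_Arg)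
    hence "Re (u j ^ k) = cmod (u j) ^ k * cos (2 * pi * of_int (p j) + 2 * pi * \<delta>)"
      by (simp add: ang)
    also have "cos (2 * pi * of_int (p j) + 2 * pi * \<delta>) = cos (2 * pi * \<delta>)"
      by (simp add: cos_add)
    also have "cos (2 * pi * \<delta>) \<ge> cos (pi / 3)"
    proof -
      have "cos (pi / 3) \<le> cos \<bar>2 * pi * \<delta>\<bar>"
      proof (rule cos_monotone_0_pi_le)
        have "\<bar>2 * pi * \<delta>\<bar> = 2 * pi * \<bar>\<delta>\<bar>" by (simp add: abs_mult)
        also have "\<dots> \<le> 2 * pi * (1 / 8)" using \<delta> by (intro mult_left_mono) auto
        finally show "\<bar>2 * pi * \<delta>\<bar> \<le> pi / 3" using pi_gt_zero by linarith
      qed auto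
      thus ?thesis by simp
    qed
    hence "cmod (u j) ^ k * cos (2 * pi * \<delta>) \<ge> cmod (u j) ^ k * (1 / 2)"
      by (intro mult_left_mono) (auto simp: cos_60)
    finally show ?thesis by simp
  qed
  have "cmod (u i) ^ k / 2 \<le> Re (u i ^ k)" using Re \<open>i < n\<close> by blast
  also have "\<dots> \<le> (\<Sum>j<n. Re (u j ^ k))"
  proof (rule member_le_sum)
    show "0 \<le> Re (u j ^ k)" if "j \<in> {..<n} - {i}" for j
      using Re[of j] that order_trans[of 0 "cmod (u j) ^ k / 2" "Re (u j ^ k)"] by simp
  qed (use \<open>i < n\<close> in auto)
  also have "\<dots> = Re (\<Sum>j<n. u j ^ k)" by simp
  also have "\<dots> \<le> C" using bound[of k] k1 complex_Re_le_cmod[of "\<Sum>j<n. u j ^ k"] by (simp add: M_def)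
  finally have "cmod (u i) ^ k \<le> 2 * C" by simp
  moreover have "cmod (u i) ^ M \<le> cmod (u i) ^ k" using gt k1 by (intro power_increasing) auto
  ultimately show False using M by simp
qed

text \<open>
  The recurrence is the identity \<open>X * L' = L * S\<close> between the generating functions
  \<open>L = \<Sum>n. c n * X ^ n\<close> and \<open>S = \<Sum>n\<ge>1. s n * X ^ n\<close>. Here \<open>L\<close> is a polynomial with constant
  term \<open>1\<close>, hence a product of factors \<open>1 - w * X\<close>, and \<open>S\<close> is its logarithmic derivative.
\<close>
lemma newton_recurrence_imp_power_sums:
  fixes c s :: "nat \<Rightarrow> complex"
  assumes c0: "c 0 = 1" and cr: "\<And>n. n \<ge> r \<Longrightarrow> c n = 0"
  assumes newton: "\<And>n. n \<ge> 1 \<Longrightarrow> of_nat n * c n = (\<Sum>k=1..n. s k * c (n - k))"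
  obtains ws where "length ws < r" "\<And>n. n \<ge> 1 \<Longrightarrow> s n = - (\<Sum>w\<leftarrow>ws. w ^ n)"
proof -
  have r: "r > 0" using c0 cr[of 0] by (cases r) auto
  define L where "L = poly_of_list (map c [0..<r])"
  have coeff_L: "coeff L n = c n" for n
    using cr[of n] by (auto simp: L_def coeff_Poly nth_default_def simp del: upt_Suc)
  have "degree L \<le> r - 1"
    by (rule degree_le) (use coeff_L cr in auto)
  hence degL: "degree L < r" using r by linarith
  obtain as where as: "Polynomial.smult (lead_coeff L) (\<Prod>a\<leftarrow>as. [:- a, 1:]) = L" "length as = degree L"
    using fundamental_theorem_algebra_factorized by blast
  have L1: "poly L 0 = 1" using coeff_L[of 0] c0 by (simp add: poly_0_coeff_0)
  have as0: "a \<noteq> 0" if "a \<in> set as" for a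
  proof
    assume "a = 0"
    have "poly (\<Prod>a\<leftarrow>as. [:- a, 1:]) 0 = 0"
      using that \<open>a = 0\<close> by (induction as) auto
    hence "poly L 0 = 0" by (subst as(1)[symmetric]) simp
    thus False using L1 by simp
  qed
  define ws where "ws = map inverse as"
  have "\<exists>C. (\<Prod>a\<leftarrow>as. [:- a, 1:]) = Polynomial.smult C (\<Prod>w\<leftarrow>map inverse as. [:1, -w:])"
    using as0
  proof (induction as)
    case (Cons a as)
    then obtain C where C: "(\<Prod>a\<leftarrow>as. [:- a, 1:]) = Polynomial.smult C (\<Prod>w\<leftarrow>map inverse as. [:1, -w:])"
      by auto
    have "[:-a, 1:] = Polynomial.smult (-a) [:1, -inverse a:]" using Cons.prems[of a] by simp
    thus ?case using C by (intro exI[of _ "-a*C"]) (simp add: mult.commute del: mult_pCons_left mult_pCons_right smult_pCons)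
  qed (auto intro: exI[of _ 1])
  then obtain C where C: "L = Polynomial.smult C (\<Prod>w\<leftarrow>ws. [:1, -w:])"
    using as(1)[symmetric] unfolding ws_def by auto
  have "poly (\<Prod>w\<leftarrow>ws. [:1, -w:]) 0 = 1" by (induction ws) auto
  hence "C = 1" using L1 by (subst (asm) C) simp
  hence Lws: "L = (\<Prod>w\<leftarrow>ws. [:1, -w:])" using C by simp
  define G where "G = (\<lambda>ws :: complex list. Abs_fps (\<lambda>n. if n = 0 then 0 else - (\<Sum>w\<leftarrow>ws. w ^ n)))"
  have geom: "(1 - fps_const w * fps_X) * G [w] = - (fps_const w * fps_X)" for w
  proof (rule fps_ext)
    fix n show "fps_nth ((1 - fps_const w * fps_X) * G [w]) n = fps_nth (- (fps_const w * fps_X)) n"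
      by (cases n) (auto simp: G_def algebra_simps)
  qed
  have log_deriv: "fps_X * fps_deriv (fps_of_poly (\<Prod>w\<leftarrow>vs. [:1, -w:]))
        = fps_of_poly (\<Prod>w\<leftarrow>vs. [:1, -w:]) * G vs" for vs
  proof (induction vs)
    case Nil
    have "G [] = 0" by (rule fps_ext) (simp add: G_def)
    thus ?case by simp
  next
    case (Cons w vs)
    define Q where "Q = fps_of_poly (\<Prod>w\<leftarrow>vs. [:1, -w:])"
    define W where "W = (1 - fps_const w * fps_X)"
    have dW: "fps_deriv W = - fps_const w" by (simp add: W_def)
    have fW: "fps_of_poly [:1, -w:] = W"
      by (simp add: W_def fps_of_poly_pCons fps_const_neg [symmetric] del: fps_const_neg)
    have GC: "G (w # vs) = G [w] + G vs"
      by (rule fps_ext) (simp add: G_def)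
    have "fps_of_poly (\<Prod>w\<leftarrow>w # vs. [:1, -w:]) = W * Q"
      using fW by (simp add: fps_of_poly_mult Q_def del: mult_pCons_left mult_pCons_right)
    moreover have "fps_X * fps_deriv (W * Q) = (W * Q) * G (w # vs)"
    proof -
      have "fps_X * fps_deriv (W * Q) = - (fps_const w * fps_X) * Q + W * (fps_X * fps_deriv Q)"
        by (simp add: dW algebra_simps flip: fps_const_neg)
      also have "\<dots> = (W * G [w]) * Q + W * (Q * G vs)"
        using Cons.IH geom[of w] by (simp add: Q_def W_def)
      also have "\<dots> = (W * Q) * G (w # vs)" by (simp add: GC algebra_simps)
      finally show ?thesis .
    qed
    ultimately show ?case by simp
  qed
  define S where "S = Abs_fps (\<lambda>n. if n = 0 then 0 else s n)"
  have XS: "fps_X * fps_deriv (fps_of_poly L) = fps_of_poly L * S"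
  proof (rule fps_ext)
    fix n
    show "fps_nth (fps_X * fps_deriv (fps_of_poly L)) n = fps_nth (fps_of_poly L * S) n"
    proof (cases "n = 0")
      case True thus ?thesis by (simp add: S_def)
    next
      case False
      have "fps_nth (fps_of_poly L * S) n = (\<Sum>i=0..n. fps_nth S i * c (n - i))"
        by (subst mult.commute) (simp add: fps_mult_nth coeff_L)
      also have "\<dots> = (\<Sum>i=1..n. fps_nth S i * c (n - i))"
        by (rule sum.mono_neutral_right) (auto simp: S_def)
      also have "\<dots> = (\<Sum>i=1..n. s i * c (n - i))"
        by (rule sum.cong) (auto simp: S_def)
      also have "\<dots> = of_nat n * c n" using newton[of n] False by simp
      finally show ?thesis using False by (cases n) (auto simp: coeff_L)
    qed
  qed
  have "fps_of_poly L * S = fps_of_poly L * G ws"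
    using XS log_deriv[of ws] by (simp flip: Lws)
  moreover have "fps_of_poly L \<noteq> 0" using L1 by auto
  ultimately have SG: "S = G ws" by simp
  show ?thesis
  proof (rule that)
    show "length ws < r" using degL as(2) by (simp add: ws_def)
    fix n :: nat assume "n \<ge> 1"
    have "fps_nth S n = fps_nth (G ws) n" using SG by simp
    thus "s n = - (\<Sum>w\<leftarrow>ws. w ^ n)" using \<open>n \<ge> 1\<close> by (simp add: S_def G_def)
  qed
qed

text \<open>
  Applied below with \<open>L\<close> the L-function of a character sum: \<open>c 1\<close> is the sum over the prime field,
  \<open>s n\<close> is the sum over the field of degree \<open>n\<close>. A bound of the right order of magnitude for the
  latter, with an arbitrarily bad constant \<open>K\<close>, gives the optimal bound for the reciprocal
  roots of \<open>L\<close>, and thus a bound for the former in which \<open>K\<close> has disappeared. Even degrees suffice, because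
  the squares of the reciprocal roots can be used in place of the roots.
\<close>
lemma newton_recurrence_first_coeff_bound:
  fixes c s :: "nat \<Rightarrow> complex" and q K :: real
  assumes c0: "c 0 = 1" and cr: "\<And>n. n \<ge> r \<Longrightarrow> c n = 0"
  assumes newton: "\<And>n. n \<ge> 1 \<Longrightarrow> of_nat n * c n = (\<Sum>k=1..n. s k * c (n - k))"
  assumes q: "q > 0" and bound: "\<And>k. k \<ge> 1 \<Longrightarrow> cmod (s (2 * k)) \<le> K * q ^ k"
  shows "cmod (c 1) \<le> real r * sqrt q"
proof -
  obtain ws where ws: "length ws < r" "\<And>n. n \<ge> 1 \<Longrightarrow> s n = - (\<Sum>w\<leftarrow>ws. w ^ n)"
    using newton_recurrence_imp_power_sums[OF c0 cr newton] by blast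
  define u where "u = (\<lambda>i. (ws ! i) ^ 2 / of_real q)"
  have "cmod (\<Sum>i<length ws. u i ^ k) \<le> K" if "k \<ge> 1" for k
  proof -
    have "(\<Sum>i<length ws. u i ^ k) = (\<Sum>w\<leftarrow>ws. w ^ (2 * k)) / of_real q ^ k"
      by (simp add: sum_list_sum_nth u_def atLeast0LessThan sum_divide_distrib power_divide
          flip: power_mult)
    hence *: "cmod (\<Sum>i<length ws. u i ^ k) = cmod (s (2 * k)) / q ^ k"
      using that q by (simp add: ws(2) norm_divide norm_power)
    show ?thesis unfolding * using bound[OF that] q by (simp add: divide_le_eq)
  qed
  hence u1: "cmod (u i) \<le> 1" if "i < length ws" for i
    using bounded_power_sums_imp_norm_le_1[of u "length ws" K] that by blast
  have w: "cmod w \<le> sqrt q" if w_mem: "w \<in> set ws" for w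
  proof -
    obtain i where i: "i < length ws" "w = ws ! i" using w_mem by (auto simp: in_set_conv_nth)
    have "cmod w ^ 2 \<le> q" using u1[OF i(1)] q by (simp add: u_def i norm_divide norm_power field_simps)
    thus ?thesis by (rule real_le_rsqrt)
  qed
  have "c 1 = s 1" using newton[of 1] c0 by simp
  hence "cmod (c 1) = cmod (\<Sum>w\<leftarrow>ws. w)" using ws(2)[of 1] by simp
  also have "\<dots> \<le> real (length ws) * sqrt q"
    using w
  proof (induction ws)
    case (Cons w ws)
    have "cmod (w + sum_list ws) \<le> cmod w + cmod (sum_list ws)" by (rule norm_triangle_ineq)
    moreover have "cmod w \<le> sqrt q" "cmod (sum_list ws) \<le> real (length ws) * sqrt q"
      using Cons.prems[of w] Cons.IH Cons.prems by auto
    ultimately show ?case by (simp add: algebra_simps)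
  qed simp
  also have "\<dots> \<le> real r * sqrt q" using ws(1) q by (intro mult_right_mono) auto
  finally show ?thesis .
qed

section \<open>Monic polynomials over a finite field\<close>

text \<open>
  A condition on coefficients rather than on the degree, so that the zero polynomial is treated
  correctly for every \<open>n\<close>: this is a vector space of dimension \<open>n\<close> over the coefficient field,
  also for \<open>n = 0\<close>.
\<close>
definition polys_below :: "nat \<Rightarrow> 'f::zero poly set" where
  "polys_below n = {h. \<forall>i\<ge>n. coeff h i = 0}"

definition monics :: "nat \<Rightarrow> 'f::zero_neq_one poly set" where
  "monics n = {g. degree g = n \<and> coeff g n = 1}"

lemma card_polys_below:
  fixes n :: nat
  shows "finite (polys_below n :: 'f::{finite,field} poly set)"
    and "card (polys_below n :: 'f poly set) = CARD('f) ^ n"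
proof -
  have bij: "bij_betw (\<lambda>h. restrict (coeff h) {..<n}) (polys_below n :: 'f poly set)
    ({..<n} \<rightarrow>\<^sub>E UNIV)"
  proof (rule bij_betwI[where g = "\<lambda>f. poly_of_list (map f [0..<n])"], goal_cases)
    case 3
    thus ?case
      by (intro poly_eqI) (auto simp: polys_below_def coeff_Poly nth_default_def not_less simp del: upt_Suc)
  next
    case 4
    thus ?case
      by (auto simp: coeff_Poly nth_default_def fun_eq_iff PiE_def extensional_def simp del: upt_Suc)
  qed (auto simp: polys_below_def coeff_Poly nth_default_def simp del: upt_Suc)
  show "finite (polys_below n :: 'f poly set)"
    using bij_betw_finite[OF bij] by (simp add: finite_PiE)
  show "card (polys_below n :: 'f poly set) = CARD('f) ^ n"
    using bij_betw_same_card[OF bij] by (simp add: card_PiE)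
qed

lemma monics_eq_image:
  "(monics n :: 'f::field poly set) = (\<lambda>h. monom 1 n + h) ` polys_below n"
proof (intro equalityI subsetI)
  fix g :: "'f poly" assume g: "g \<in> monics n"
  have "g - monom 1 n \<in> polys_below n"
    using g by (auto simp: monics_def polys_below_def coeff_eq_0 le_less)
  thus "g \<in> (\<lambda>h. monom 1 n + h) ` polys_below n" by (intro image_eqI[of _ _ "g - monom 1 n"]) auto
next
  fix g :: "'f poly" assume "g \<in> (\<lambda>h. monom 1 n + h) ` polys_below n"
  then obtain h where h: "g = monom 1 n + h" "h \<in> polys_below n" by auto
  have "coeff g n = 1" "degree g \<le> n"
    using h by (auto simp: polys_below_def intro!: degree_le)
  thus "g \<in> monics n" using le_degree[of g n] by (auto simp: monics_def)
qed

lemma card_monics: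
  shows "finite (monics n :: 'f::{finite,field} poly set)"
    and "card (monics n :: 'f poly set) = CARD('f) ^ n"
  by (auto simp: monics_eq_image card_polys_below card_image inj_on_def)

lemma monics_0: "monics 0 = {1 :: 'f::field poly}"
  by (auto simp: monics_def elim!: degree_eq_zeroE)

lemma prime_imp_monic:
  fixes g :: "'f::field_gcd poly"
  assumes "prime g"
  shows "lead_coeff g = 1" "degree g > 0" "g \<noteq> 0" "g \<in> monics (degree g)"
proof -
  show "g \<noteq> 0" using assms by auto
  have "normalize g = g" using assms by (simp add: prime_def)
  thus 1: "lead_coeff g = 1"
    using monic_normalize[OF \<open>g \<noteq> 0\<close>] by simp
  show "degree g > 0"
    using assms is_unit_iff_degree[OF \<open>g \<noteq> 0\<close>] not_prime_unit[of g] by blast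
  show "g \<in> monics (degree g)" using 1 by (simp add: monics_def)
qed

definition prime_powers_of_degree :: "nat \<Rightarrow> ('f::field_gcd poly \<times> nat) set" where
  "prime_powers_of_degree n = {(\<pi>, j). prime \<pi> \<and> j \<ge> 1 \<and> j * degree \<pi> = n}"

lemma finite_prime_powers_of_degree:
  "finite (prime_powers_of_degree n :: ('f::{finite,field_gcd} poly \<times> nat) set)"
proof (rule finite_subset)
  show "(prime_powers_of_degree n :: ('f poly \<times> nat) set) \<subseteq> (\<Union>k\<le>n. monics k) \<times> {..n}"
  proof
    fix x assume "x \<in> (prime_powers_of_degree n :: ('f poly \<times> nat) set)"
    then obtain \<pi> j where x: "x = (\<pi>, j)" "prime \<pi>" "j \<ge> 1" "j * degree \<pi> = n"
      by (auto simp: prime_powers_of_degree_def)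
    have "degree \<pi> > 0" "\<pi> \<in> monics (degree \<pi>)" using prime_imp_monic x by auto
    moreover have "degree \<pi> \<le> n" using x by auto
    moreover have "j \<le> n" using x(4) \<open>degree \<pi> > 0\<close> by auto
    ultimately show "x \<in> (\<Union>k\<le>n. monics k) \<times> {..n}" using x(1) by blast
  qed
qed (auto simp: card_monics)

lemma inj_on_fst_prime_powers_of_degree:
  assumes "n > 0"
  shows "inj_on fst (prime_powers_of_degree n)"
proof (rule inj_onI)
  fix x y :: "'f::field_gcd poly \<times> nat"
  assume xy: "x \<in> prime_powers_of_degree n" "y \<in> prime_powers_of_degree n" "fst x = fst y"
  have "snd x * degree (fst x) = n" "snd y * degree (fst x) = n"
    using xy by (auto simp: prime_powers_of_degree_def)
  hence "snd x * degree (fst x) = snd y * degree (fst x)" "degree (fst x) \<noteq> 0"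
    using assms by (simp, metis mult_0_right less_irrefl)
  thus "x = y" using xy(3) by (simp add: prod_eq_iff)
qed

text \<open>
  The sum of \<open>F\<close> over all monic polynomials of degree \<open>n\<close> with the von Mangoldt weight, which is
  \<open>degree \<pi>\<close> at the powers of an irreducible \<open>\<pi>\<close>. When \<open>F\<close> is a character composed with a norm, it is
  the corresponding character sum over the extension of degree \<open>n\<close>: an element of the extension
  whose minimal polynomial \<open>\<pi>\<close> has degree \<open>n div j\<close> contributes \<open>F \<pi> ^ j\<close>, and \<open>\<pi>\<close> has \<open>degree \<pi>\<close> roots.
\<close>
definition prime_power_sum :: "('f::field_gcd poly \<Rightarrow> 'c::comm_semiring_1) \<Rightarrow> nat \<Rightarrow> 'c" where
  "prime_power_sum F n = (\<Sum>(\<pi>, j)\<in>prime_powers_of_degree n. of_nat (degree \<pi>) * F \<pi> ^ j)"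

text \<open>
  The polynomial analogue of \<open>ln n = (\<Sum>d | d dvd n. \<Lambda> d)\<close>: an irreducible factor of multiplicity \<open>v\<close>
  occurs with the exponents \<open>1, \<dots>, v\<close>.
\<close>
lemma degree_eq_sum_prime_powers:
  fixes g :: "'f::{finite,field_gcd} poly"
  assumes g: "g \<in> monics n"
  shows "(\<Sum>x\<in>{x\<in>(\<Union>k\<in>{1..n}. prime_powers_of_degree k). fst x ^ snd x dvd g}. degree (fst x)) = n"
proof -
  have deg: "degree g = n" and lc: "lead_coeff g = 1" using g by (auto simp: monics_def)
  have g0: "g \<noteq> 0" using lc by auto
  have set_eq: "{x\<in>(\<Union>k\<in>{1..n}. prime_powers_of_degree k). fst x ^ snd x dvd g}
     = Sigma (prime_factors g) (\<lambda>\<pi>. {1..multiplicity \<pi> g})" (is "?L = ?R")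
  proof (intro equalityI subsetI)
    fix x assume "x \<in> ?L"
    then obtain \<pi> j where x: "x = (\<pi>, j)" "prime \<pi>" "j \<ge> 1" "\<pi> ^ j dvd g"
      by (auto simp: prime_powers_of_degree_def)
    have "j \<le> multiplicity \<pi> g"
      using x g0 not_prime_unit[of \<pi>] by (intro multiplicity_geI) auto
    moreover have "\<pi> dvd g" using x dvd_power[of j \<pi>] dvd_trans[of \<pi> "\<pi> ^ j" g] by auto
    ultimately show "x \<in> ?R" using x g0 by (auto simp: in_prime_factors_iff)
  next
    fix x assume "x \<in> ?R"
    then obtain \<pi> j where x: "x = (\<pi>, j)" "\<pi> \<in> prime_factors g" "j \<ge> 1" "j \<le> multiplicity \<pi> g"
      by auto
    have dvd: "\<pi> ^ j dvd g" using x by (intro multiplicity_dvd')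
    have pr: "prime \<pi>" using x(2) by auto
    have "j * degree \<pi> \<le> n"
      using dvd_imp_degree_le[OF dvd g0] deg by (simp add: degree_power_eq prime_imp_monic[OF pr] mult.commute)
    moreover have "j * degree \<pi> \<ge> 1" using x(3) prime_imp_monic(2)[OF pr] by simp
    ultimately have "(\<pi>, j) \<in> prime_powers_of_degree (j * degree \<pi>)" "j * degree \<pi> \<in> {1..n}"
      using x pr by (auto simp: prime_powers_of_degree_def)
    thus "x \<in> ?L" using x(1) dvd by (intro CollectI conjI UN_I) auto
  qed
  have "(\<Sum>x\<in>?L. degree (fst x)) = (\<Sum>\<pi>\<in>prime_factors g. \<Sum>j\<in>{1..multiplicity \<pi> g}. degree \<pi>)"
    unfolding set_eq by (subst sum.Sigma) (auto simp: case_prod_unfold)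
  also have "\<dots> = (\<Sum>\<pi>\<in>prime_factors g. degree (\<pi> ^ multiplicity \<pi> g))"
    proof (intro sum.cong refl)
    fix \<pi> assume "\<pi> \<in> prime_factors g"
    hence "\<pi> \<noteq> 0" by auto
    thus "(\<Sum>j\<in>{1..multiplicity \<pi> g}. degree \<pi>) = degree (\<pi> ^ multiplicity \<pi> g)"
      by (simp add: degree_power_eq mult.commute)
  qed
  also have "\<dots> = degree (\<Prod>\<pi>\<in>prime_factors g. \<pi> ^ multiplicity \<pi> g)"
    by (rule degree_prod_eq_sum_degree [symmetric]) auto
  also have "(\<Prod>\<pi>\<in>prime_factors g. \<pi> ^ multiplicity \<pi> g) = normalize g"
    using g0 by (simp add: prod_prime_factors)
  also have "degree (normalize g) = n" using deg by simp
  finally show ?thesis .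
qed

text \<open>
  This is the logarithmic derivative of the Euler product of \<open>\<Sum>g. F g * T ^ degree g\<close>, written for
  coefficients: insert \<open>n = (\<Sum>\<pi> ^ j dvd g. degree \<pi>)\<close> on the left-hand side and sum first over
  the multiples \<open>\<pi> ^ j * h\<close> of a fixed prime power.
\<close>
lemma newton_recurrence_monics:
  fixes F :: "'f::{finite,field_gcd} poly \<Rightarrow> 'c::comm_semiring_1"
  assumes mult: "\<And>g h. F (g * h) = F g * F h" and one: "F 1 = 1"
  shows "of_nat n * (\<Sum>g\<in>monics n. F g)
    = (\<Sum>k=1..n. prime_power_sum F k * (\<Sum>g\<in>monics (n - k). F g))"
proof -
  let ?PP = "\<lambda>k. prime_powers_of_degree k :: ('f poly \<times> nat) set"
  let ?U = "\<Union>k\<in>{1..n}. ?PP k"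
  have finU: "finite ?U" by (auto simp: finite_prime_powers_of_degree)
  have Fpow: "F (g ^ j) = F g ^ j" for g j by (induction j) (auto simp: mult one)
  have "of_nat n * (\<Sum>g\<in>monics n. F g)
      = (\<Sum>g\<in>monics n. of_nat (\<Sum>x\<in>{x\<in>?U. fst x ^ snd x dvd g}. degree (fst x)) * F g)"
    unfolding sum_distrib_left by (rule sum.cong[OF refl]) (simp only: degree_eq_sum_prime_powers)
  also have "\<dots> = (\<Sum>g\<in>monics n. \<Sum>x\<in>{x\<in>?U. fst x ^ snd x dvd g}. of_nat (degree (fst x)) * F g)"
    by (simp add: sum_distrib_right)
  also have "\<dots> = (\<Sum>g\<in>monics n. \<Sum>x\<in>?U. if fst x ^ snd x dvd g then of_nat (degree (fst x)) * F g else 0)"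
    by (rule sum.cong[OF refl], rule sum.inter_filter[OF finU])
  also have "\<dots> = (\<Sum>x\<in>?U. \<Sum>g\<in>monics n. if fst x ^ snd x dvd g then of_nat (degree (fst x)) * F g else 0)"
    by (rule sum.swap)
  also have "\<dots> = (\<Sum>k=1..n. \<Sum>x\<in>?PP k. \<Sum>g\<in>monics n. if fst x ^ snd x dvd g then of_nat (degree (fst x)) * F g else 0)"
  proof (rule sum.UNION_disjoint)
    show "\<forall>k\<in>{1..n}. finite (?PP k)" using finite_prime_powers_of_degree by blast
    show "\<forall>i\<in>{1..n}. \<forall>j\<in>{1..n}. i \<noteq> j \<longrightarrow> ?PP i \<inter> ?PP j = {}"
      by (auto simp: prime_powers_of_degree_def)
  qed simp
  also have "\<dots> = (\<Sum>k=1..n. \<Sum>x\<in>?PP k. of_nat (degree (fst x)) * F (fst x) ^ snd x * (\<Sum>h\<in>monics (n - k). F h))"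
  proof (intro sum.cong refl)
    fix k x assume k: "k \<in> {1..n}" and x: "x \<in> ?PP k"
    obtain \<pi> j where x_eq: "x = (\<pi>, j)" and \<pi>: "prime \<pi>" "j * degree \<pi> = k"
      using x by (auto simp: prime_powers_of_degree_def)
    have lc: "lead_coeff (\<pi> ^ j) = 1" and \<pi>0: "\<pi> \<noteq> 0"
      using prime_imp_monic[OF \<pi>(1)] by (auto simp: lead_coeff_power)
    have deg: "degree (\<pi> ^ j) = k" using \<pi> \<pi>0 by (simp add: degree_power_eq mult.commute)
    have img: "{g \<in> monics n. \<pi> ^ j dvd g} = (\<lambda>h. \<pi> ^ j * h) ` monics (n - k)"
    proof (intro equalityI subsetI)
      fix g assume "g \<in> {g \<in> monics n. \<pi> ^ j dvd g}"
      hence "\<pi> ^ j dvd g" and g: "degree g = n" "lead_coeff g = 1" by (auto simp: monics_def)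
      then obtain h where h: "g = \<pi> ^ j * h" by (elim dvdE)
      have "h \<noteq> 0" using g h by auto
      hence "degree g = k + degree h" using h deg \<pi>0 by (simp add: degree_mult_eq)
      moreover have "lead_coeff h = 1" using g(2) lc unfolding h by (simp add: lead_coeff_mult)
      ultimately have "h \<in> monics (n - k)" using g by (auto simp: monics_def)
      thus "g \<in> (\<lambda>h. \<pi> ^ j * h) ` monics (n - k)" using h by blast
    next
      fix g assume "g \<in> (\<lambda>h. \<pi> ^ j * h) ` monics (n - k)"
      then obtain h where h: "g = \<pi> ^ j * h" and hm: "degree h = n - k" "lead_coeff h = 1"
        by (auto simp: monics_def)
      have "h \<noteq> 0" using hm by auto
      hence dg: "degree g = n" using h deg \<pi>0 hm k by (simp add: degree_mult_eq)
      have "lead_coeff g = 1" using hm(2) lc unfolding h by (simp add: lead_coeff_mult)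
      thus "g \<in> {g \<in> monics n. \<pi> ^ j dvd g}" using dg h by (auto simp: monics_def)
    qed
    have "(\<Sum>g\<in>monics n. if fst x ^ snd x dvd g then of_nat (degree (fst x)) * F g else 0)
      = (\<Sum>g\<in>{g \<in> monics n. \<pi> ^ j dvd g}. of_nat (degree \<pi>) * F g)"
      unfolding x_eq fst_conv snd_conv by (rule sum.inter_filter[symmetric]) (rule card_monics)
    also have "\<dots> = (\<Sum>h\<in>monics (n - k). of_nat (degree \<pi>) * F (\<pi> ^ j * h))"
      unfolding img by (subst sum.reindex) (use \<pi>0 in \<open>auto simp: inj_on_def\<close>)
    also have "\<dots> = of_nat (degree \<pi>) * F \<pi> ^ j * (\<Sum>h\<in>monics (n - k). F h)"
      by (simp add: mult Fpow sum_distrib_left mult_ac)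
    finally show "(\<Sum>g\<in>monics n. if fst x ^ snd x dvd g then of_nat (degree (fst x)) * F g else 0)
      = of_nat (degree (fst x)) * F (fst x) ^ snd x * (\<Sum>h\<in>monics (n - k). F h)" by (simp add: x_eq)
  qed
  also have "\<dots> = (\<Sum>k=1..n. prime_power_sum F k * (\<Sum>g\<in>monics (n - k). F g))"
    by (simp add: prime_power_sum_def case_prod_unfold sum_distrib_right)
  finally show ?thesis .
qed

text \<open>
  The exact prime number theorem for polynomials: for trivial \<open>F\<close> the recurrence has the
  coefficients \<open>CARD('f) ^ n\<close>, and it determines its power sums.
\<close>
lemma prime_power_sum_trivial:
  assumes "n \<ge> 1"
  shows "prime_power_sum (\<lambda>_ :: 'f::{finite,field_gcd} poly. 1) n = (CARD('f) ^ n :: nat)"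
  using assms
proof (induction n rule: less_induct)
  case (less n)
  let ?q = "CARD('f)" and ?s = "\<lambda>k. prime_power_sum (\<lambda>_ :: 'f poly. 1) k :: nat"
  have split: "{1..n} = insert n {1..<n}" using less.prems by auto
  have "n * ?q ^ n = (\<Sum>k=1..n. ?s k * ?q ^ (n - k))"
    using newton_recurrence_monics[of "\<lambda>_ :: 'f poly. 1 :: nat" n] by (simp add: card_monics)
  also have "\<dots> = ?s n + (\<Sum>k\<in>{1..<n}. ?s k * ?q ^ (n - k))"
    unfolding split by simp
  also have "(\<Sum>k\<in>{1..<n}. ?s k * ?q ^ (n - k)) = (\<Sum>k\<in>{1..<n}. ?q ^ n)"
    using less.IH by (intro sum.cong refl) (auto simp flip: power_add)
  also have "\<dots> = (n - 1) * ?q ^ n" by simp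
  finally have "?s n + (n - 1) * ?q ^ n = n * ?q ^ n" ..
  also have "\<dots> = ?q ^ n + (n - 1) * ?q ^ n" using less.prems by (cases n) auto
  finally show ?case by simp
qed

section \<open>Norms and values of irreducible polynomials\<close>

text \<open>
  Raising to the power \<open>CARD('a) ^ i\<close> is additive and fixes the constants.
\<close>
lemma power_card_eq_pcompose:
  fixes g :: "'a::prime_card mod_ring poly"
  shows "g ^ (CARD('a) ^ i) = pcompose g ([:0, 1:] ^ (CARD('a) ^ i))"
proof (induction g)
  case (pCons a g)
  have "pCons a g = [:a:] + [:0, 1:] * g" by simp
  hence "pCons a g ^ (CARD('a) ^ i) = [:a:] ^ (CARD('a) ^ i) + ([:0, 1:] * g) ^ (CARD('a) ^ i)"
    by (simp only: add_power_prime_poly_mod_ring)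
  also have "\<dots> = [:a:] + [:0, 1:] ^ (CARD('a) ^ i) * g ^ (CARD('a) ^ i)"
    by (simp only: fermat_theorem_power_poly power_mult_distrib)
  also have "\<dots> = pcompose (pCons a g) ([:0, 1:] ^ (CARD('a) ^ i))"
    by (simp only: pcompose_pCons pCons.IH)
  finally show ?case .
next
  case 0 show ?case by simp
qed

lemma pcompose_cong:
  fixes m :: "'f::field_gcd poly"
  assumes "[u = v] (mod m)"
  shows "[pcompose g u = pcompose g v] (mod m)"
proof (induction g)
  case (pCons a g)
  show ?case unfolding pcompose_pCons by (intro cong_add cong_mult cong_refl assms pCons.IH)
next
  case 0 show ?case by simp
qed

lemma X_power_card_cong:
  fixes \<pi> :: "'a::prime_card mod_ring poly"
  assumes "prime \<pi>"
  shows "[[:0, 1:] ^ (CARD('a) ^ degree \<pi>) = [:0, 1:]] (mod \<pi>)"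
proof -
  have "irreducible \<pi>" using assms by (intro prime_elem_imp_irreducible) auto
  hence "\<pi> dvd monom 1 1 ^ (CARD('a) ^ degree \<pi>) - monom 1 1"
    by (rule degree_divisor1) simp
  thus ?thesis by (simp only: cong_iff_dvd_diff x_as_monom)
qed

lemma power_card_cong:
  fixes \<pi> :: "'a::prime_card mod_ring poly"
  assumes "prime \<pi>"
  shows "[g ^ (CARD('a) ^ degree \<pi>) = g] (mod \<pi>)"
  using pcompose_cong[OF X_power_card_cong[OF assms], of g]
  by (simp only: power_card_eq_pcompose[of g] pcompose_idR)

text \<open>
  In a field extension of \<open>F\<^sub>p\<close> the roots of \<open>y ^ p - y = (\<Prod>x\<in>F\<^sub>p. y - x)\<close> are the elements of
  \<open>F\<^sub>p\<close>. The same factorisation works modulo the prime \<open>\<pi>\<close>.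
\<close>
lemma frobenius_fixed_cong_const:
  fixes \<pi> :: "'a::prime_card mod_ring poly"
  assumes "prime \<pi>" and "\<pi> dvd c ^ CARD('a) - c"
  obtains a where "[c = [:a:]] (mod \<pi>)"
proof -
  have "\<pi> dvd (\<Prod>x\<in>UNIV. c - [:x:])" using assms(2) by (simp only: poly_identity_mod_p)
  then obtain a where "\<pi> dvd c - [:a:]"
    using assms(1) prime_dvd_prod_iff[of UNIV \<pi> "\<lambda>x. c - [:x:]"] by auto
  thus ?thesis using that by (simp add: cong_iff_dvd_diff)
qed

text \<open>
  If \<open>\<theta>\<close> is a root of \<open>\<pi>\<close>, then the powers \<open>\<theta> ^ (p ^ i)\<close> with \<open>i < degree \<pi>\<close> are all its roots, and
  \<open>\<pi> b\<close> is the product of the \<open>b - \<theta> ^ (p ^ i)\<close>. The statement expresses this without an extension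
  field, by computing modulo \<open>\<pi>\<close> with the indeterminate in the role of \<open>\<theta>\<close>. The polynomial \<open>G\<close> in a
  second variable with the roots \<open>x ^ (p ^ i)\<close> has coefficients that are fixed by the Frobenius map
  modulo \<open>\<pi>\<close>, so modulo \<open>\<pi>\<close> it is a polynomial \<open>G0\<close> over \<open>F\<^sub>p\<close>. Since \<open>x\<close> is a root of \<open>G0\<close> modulo \<open>\<pi>\<close>
  and the degrees agree, \<open>G0 = \<pi>\<close>.
\<close>
lemma norm_linear_cong:
  fixes \<pi> :: "'a::prime_card mod_ring poly"
  assumes \<pi>: "prime \<pi>"
  shows "[(\<Prod>i<degree \<pi>. [:b:] - [:0, 1:] ^ (CARD('a) ^ i)) = [:poly \<pi> b:]] (mod \<pi>)"
proof -
  define k where "k = degree \<pi>"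
  define y where "y = (\<lambda>i. [:0, 1:] ^ (CARD('a) ^ i) :: 'a mod_ring poly)"
  define G where "G = (\<Prod>i<k. [:- y i, 1:])"
  have k0: "k > 0" using prime_imp_monic[OF \<pi>] by (simp add: k_def)
  interpret frob: comm_ring_hom "\<lambda>c :: 'a mod_ring poly. c ^ CARD('a)"
    by unfold_locales (auto simp: add_power_poly_mod_ring power_mult_distrib)
  interpret frobp: map_poly_comm_ring_hom "\<lambda>c :: 'a mod_ring poly. c ^ CARD('a)"
    by unfold_locales
  have y_Suc: "y i ^ CARD('a) = y (Suc i)" for i
    by (simp only: y_def power_Suc2 power_mult)
  have "map_poly (\<lambda>c. c ^ CARD('a)) G = (\<Prod>i<k. map_poly (\<lambda>c. c ^ CARD('a)) [:- y i, 1:])"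
    unfolding G_def by (rule frobp.hom_prod)
  also have "\<dots> = (\<Prod>i<k. [:- y (Suc i), 1:])"
    by (intro prod.cong refl) (simp add: y_Suc frob.hom_uminus)
  finally have map_G: "map_poly (\<lambda>c. c ^ CARD('a)) G = (\<Prod>i<k. [:- y (Suc i), 1:])" .
  define H where "H = (\<Prod>i<k-1. [:- y (Suc i), 1:])"
  have k_Suc: "k = Suc (k - 1)" using k0 by simp
  have G_eq: "G = [:- y 0, 1:] * H"
    unfolding G_def H_def by (subst k_Suc, subst prod.lessThan_Suc_shift) simp
  have map_G_eq: "map_poly (\<lambda>c. c ^ CARD('a)) G = H * [:- y k, 1:]"
    unfolding map_G H_def by (subst k_Suc, subst prod.lessThan_Suc) (use k0 in simp)
  have y0: "y 0 = [:0, 1:]" by (simp add: y_def)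
  \<comment> \<open>The Frobenius map replaces the root \<open>y 0\<close> of \<open>G\<close> by \<open>y k\<close>, which is congruent to \<open>y 0\<close> modulo \<open>\<pi>\<close>.\<close>
  have diff: "map_poly (\<lambda>c. c ^ CARD('a)) G - G = Polynomial.smult (y 0 - y k) H"
    unfolding map_G_eq by (subst G_eq) (simp add: algebra_simps smult_diff_left)
  have dvd_yk: "\<pi> dvd y 0 - y k"
    using cong_sym[OF X_power_card_cong[OF \<pi>]] by (simp add: y_def k_def cong_iff_dvd_diff)
  have "\<pi> dvd coeff G j ^ CARD('a) - coeff G j" for j
  proof -
    have "coeff G j ^ CARD('a) - coeff G j = coeff (map_poly (\<lambda>c. c ^ CARD('a)) G - G) j"
      by (simp add: coeff_map_poly)
    also have "\<dots> = (y 0 - y k) * coeff H j" unfolding diff by simp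
    finally show ?thesis using dvd_yk by simp
  qed
  hence "\<exists>a. [coeff G j = [:a:]] (mod \<pi>)" for j
    using frobenius_fixed_cong_const[OF \<pi>] by metis
  then obtain a where a: "\<And>j. [coeff G j = [:a j:]] (mod \<pi>)" by metis
  have degG: "degree G = k" by (simp add: G_def degree_prod_eq_sum_degree)
  have lcG: "lead_coeff G = 1" unfolding G_def lead_coeff_prod by simp
  \<comment> \<open>The coefficient of degree \<open>k\<close> is prescribed in order that \<open>G0\<close> is monic.\<close>
  define a' where "a' = (\<lambda>j. if j = k then 1 else a j)"
  have a': "[coeff G j = [:a' j:]] (mod \<pi>)" for j
    using a[of j] lcG degG by (cases "j = k") (simp_all add: a'_def)
  define G0 where "G0 = (\<Sum>j\<le>k. monom (a' j) j)"
  have coeff_G0: "coeff G0 j = (if j \<le> k then a' j else 0)" for j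
    by (simp add: G0_def coeff_sum)
  have degG0: "degree G0 = k"
    by (rule antisym[OF degree_le le_degree]) (auto simp: coeff_G0 a'_def)
  have lcG0: "lead_coeff G0 = 1" by (simp add: degG0 coeff_G0 a'_def)
  have eval: "[poly G Y = pcompose G0 Y] (mod \<pi>)" for Y
  proof -
    have pcompose_monom: "pcompose (monom c n) Y = [:c:] * Y ^ n" for c n
      by (induction n) (simp_all add: monom_0 monom_Suc pcompose_pCons)
    have "pcompose G0 Y = (\<Sum>j\<le>k. [:a' j:] * Y ^ j)"
      by (simp add: G0_def pcompose_sum pcompose_monom)
    moreover have "poly G Y = (\<Sum>j\<le>k. coeff G j * Y ^ j)"
      by (simp add: poly_altdef degG)
    moreover have "[(\<Sum>j\<le>k. coeff G j * Y ^ j) = (\<Sum>j\<le>k. [:a' j:] * Y ^ j)] (mod \<pi>)"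
      by (intro cong_sum cong_mult a' cong_refl)
    ultimately show ?thesis by simp
  qed
  have "poly G (y 0) = 0" by (simp add: G_eq)
  hence "[0 = G0] (mod \<pi>)" using eval[of "y 0"] by (simp only: y0 pcompose_idR)
  hence "\<pi> dvd G0" by (simp add: cong_iff_dvd_diff)
  then obtain w where w: "G0 = \<pi> * w" by (elim dvdE)
  have "w \<noteq> 0" using lcG0 w by auto
  hence "degree w = 0" using arg_cong[OF w, of degree] prime_imp_monic[OF \<pi>]
    by (simp add: degree_mult_eq degG0 k_def)
  moreover have "lead_coeff w = 1"
    using lcG0 prime_imp_monic(1)[OF \<pi>] unfolding w by (simp add: lead_coeff_mult)
  ultimately have "w = 1" by (auto elim!: degree_eq_zeroE)
  hence "G0 = \<pi>" using w by simp
  have "(\<Prod>i<degree \<pi>. [:b:] - [:0, 1:] ^ (CARD('a) ^ i)) = poly G [:b:]"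
    unfolding G_def poly_prod k_def y_def by (intro prod.cong refl) simp
  moreover have "pcompose \<pi> [:b:] = [:poly \<pi> b:]" by (induction \<pi>) (auto simp: pcompose_pCons)
  ultimately show ?thesis using eval[of "[:b:]"] \<open>G0 = \<pi>\<close> by (simp only:)
qed

text \<open>
  The factors are \<open>a - x\<close> and not \<open>x - a\<close>; this keeps signs out of the norm formulas.
\<close>
definition root_prod :: "'f::comm_ring_1 list \<Rightarrow> 'f poly" where
  "root_prod as = (\<Prod>a\<leftarrow>as. [:a, -1:])"

lemma root_prod_simps [simp]:
  "root_prod [] = 1" "root_prod (a # as) = [:a, -1:] * root_prod as"
  by (simp_all add: root_prod_def)

lemma norm_root_prod_prime_cong:
  fixes \<pi> :: "'a::prime_card mod_ring poly"
  assumes \<pi>: "prime \<pi>"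
  shows "[root_prod as ^ (\<Sum>i<degree \<pi>. CARD('a) ^ i) = [:\<Prod>a\<leftarrow>as. poly \<pi> a:]] (mod \<pi>)"
proof (induction as)
  case (Cons b as)
  have lin: "pcompose [:b, -1:] Y = [:b:] - Y" for Y :: "'a mod_ring poly" by simp
  have "[:b, -1:] ^ (\<Sum>i<degree \<pi>. CARD('a) ^ i) = (\<Prod>i<degree \<pi>. [:b, -1:] ^ (CARD('a) ^ i))"
    by (rule power_sum)
  also have "\<dots> = (\<Prod>i<degree \<pi>. [:b:] - [:0, 1:] ^ (CARD('a) ^ i))"
    by (intro prod.cong refl) (simp only: power_card_eq_pcompose[of "[:b, -1:]"] lin)
  finally have 1: "[[:b, -1:] ^ (\<Sum>i<degree \<pi>. CARD('a) ^ i) = [:poly \<pi> b:]] (mod \<pi>)"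
    using norm_linear_cong[OF \<pi>, of b] by (simp only:)
  have "[:poly \<pi> b:] * [:\<Prod>a\<leftarrow>as. poly \<pi> a:] = [:\<Prod>a\<leftarrow>b # as. poly \<pi> a:]" by simp
  thus ?case using cong_mult[OF 1 Cons.IH]
    by (simp only: root_prod_simps power_mult_distrib)
next
  case Nil show ?case by simp
qed

text \<open>
  For a root \<open>\<theta>\<close> of \<open>\<pi>\<close>, viewed in the extension of degree \<open>n = j * degree \<pi>\<close>, this computes the norm
  of \<open>root_prod as\<close> at \<open>\<theta>\<close>, i.e. its power with exponent \<open>1 + p + \<dots> + p ^ (n - 1)\<close>.
\<close>
lemma norm_root_prod_cong:
  fixes \<pi> :: "'a::prime_card mod_ring poly"
  assumes \<pi>: "prime \<pi>"
  shows "[root_prod as ^ (\<Sum>i<j * degree \<pi>. CARD('a) ^ i) = [:(\<Prod>a\<leftarrow>as. poly \<pi> a) ^ j:]] (mod \<pi>)"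
proof (induction j)
  case (Suc j)
  have sum_split: "(\<Sum>i<m + n. f i) = (\<Sum>i<m. f i) + (\<Sum>i<n. f (m + i))"
    for f :: "nat \<Rightarrow> nat" and m n by (induction n) (auto simp: add_ac)
  let ?k = "degree \<pi>" and ?p = "CARD('a)" and ?f = "root_prod as" and ?c = "\<Prod>a\<leftarrow>as. poly \<pi> a"
  have "(\<Sum>i<Suc j * ?k. ?p ^ i) = (\<Sum>i<j * ?k + ?k. ?p ^ i)" by (simp add: add.commute)
  also have "\<dots> = (\<Sum>i<j * ?k. ?p ^ i) + (\<Sum>i<?k. ?p ^ (j * ?k + i))"
    by (rule sum_split) 
  finally have "?f ^ (\<Sum>i<Suc j * ?k. ?p ^ i) = ?f ^ (\<Sum>i<j * ?k. ?p ^ i) * (?f ^ (\<Sum>i<?k. ?p ^ i)) ^ (?p ^ (j * ?k))"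
    by (simp only: power_add power_mult [symmetric] sum_distrib_left sum_distrib_right mult.commute)
  moreover have "[\<dots> = [:?c ^ j:] * [:?c:] ^ (?p ^ (j * ?k))] (mod \<pi>)"
    by (intro cong_mult cong_pow Suc.IH norm_root_prod_prime_cong[OF \<pi>])
  moreover have "[:?c ^ j:] * [:?c:] ^ (?p ^ (j * ?k)) = [:?c ^ Suc j:]"
    by (simp add: mult.commute)
  ultimately show ?case by (simp only:)
next
  case 0 show ?case by simp
qed

section \<open>Stepanov's method\<close>

text \<open>
  Only one term contributes to the lowest coefficient of the sum.
\<close>
lemma distinct_orders_imp_independent:
  fixes e u :: "'i \<Rightarrow> 'f::idom poly" and ord :: "'i \<Rightarrow> nat"
  assumes "finite I" and inj: "inj_on ord I"
    and e: "\<And>i. i \<in> I \<Longrightarrow> e i = monom 1 (ord i) * u i" "\<And>i. i \<in> I \<Longrightarrow> coeff (u i) 0 \<noteq> 0"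
    and zero: "(\<Sum>i\<in>I. Polynomial.smult (w i) (e i)) = 0"
    and "i \<in> I"
  shows "w i = 0"
proof (rule ccontr)
  assume "w i \<noteq> 0"
  define S where "S = {i \<in> I. w i \<noteq> 0}"
  have S: "finite S" "S \<noteq> {}" using \<open>finite I\<close> \<open>i \<in> I\<close> \<open>w i \<noteq> 0\<close> by (auto simp: S_def)
  define i0 where "i0 = arg_min_on ord S"
  have i0: "i0 \<in> S" and min: "\<And>i. i \<in> S \<Longrightarrow> ord i0 \<le> ord i"
    using arg_min_if_finite[OF S, of ord] by (auto simp: i0_def not_less)
  have "0 = coeff (\<Sum>i\<in>I. Polynomial.smult (w i) (e i)) (ord i0)" by (simp add: zero)
  also have "\<dots> = (\<Sum>i\<in>I. w i * coeff (e i) (ord i0))" by (simp add: coeff_sum)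
  also have "\<dots> = (\<Sum>i\<in>I. if i = i0 then w i0 * coeff (u i0) 0 else 0)"
  proof (rule sum.cong[OF refl])
    fix i assume i: "i \<in> I"
    show "w i * coeff (e i) (ord i0) = (if i = i0 then w i0 * coeff (u i0) 0 else 0)"
    proof (cases "i = i0")
      case True
      thus ?thesis using i by (simp add: e coeff_monom_mult)
    next
      case False
      have "coeff (e i) (ord i0) = 0" if "w i \<noteq> 0"
      proof -
        have "ord i0 \<le> ord i" using min that i by (auto simp: S_def)
        moreover have "ord i0 \<noteq> ord i" using inj False i i0 by (auto simp: inj_on_def S_def)
        ultimately show ?thesis using i by (simp add: e coeff_monom_mult)
      qed
      thus ?thesis using False by auto
    qed
  qed
  also have "\<dots> = w i0 * coeff (u i0) 0"
    using i0 \<open>finite I\<close> by (simp add: S_def sum.delta')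
  finally show False using i0 e(2)[of i0] by (auto simp: S_def)
qed

text \<open>
  A homogeneous linear system with more unknowns than equations. Over a finite field the pigeonhole
  principle solves it: there are more coefficient vectors than possible values.
\<close>
lemma exists_nontrivial_vanishing_combination:
  fixes z :: "'i \<Rightarrow> 'f::{finite,field} poly"
  assumes "finite I" and z: "\<And>i. i \<in> I \<Longrightarrow> z i \<in> polys_below n" and "n < card I"
  obtains w i where "i \<in> I" "w i \<noteq> 0" "(\<Sum>i\<in>I. Polynomial.smult (w i) (z i)) = 0"
proof -
  define \<Phi> where "\<Phi> = (\<lambda>w. \<Sum>i\<in>I. Polynomial.smult (w i) (z i))"
  have q: "CARD('f) > 1"
    using card_mono[of UNIV "{0, 1 :: 'f}"] by simp
  have "\<Phi> ` (I \<rightarrow>\<^sub>E UNIV) \<subseteq> polys_below n"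
    using z by (auto simp: \<Phi>_def polys_below_def coeff_sum)
  hence "card (\<Phi> ` (I \<rightarrow>\<^sub>E UNIV)) \<le> CARD('f) ^ n"
    using card_mono[OF card_polys_below(1)] card_polys_below(2) by metis
  also have "\<dots> < CARD('f) ^ card I" using \<open>n < card I\<close> q by simp
  also have "\<dots> = card (I \<rightarrow>\<^sub>E (UNIV :: 'f set))" using \<open>finite I\<close> by (simp add: card_PiE)
  finally have "\<not> inj_on \<Phi> (I \<rightarrow>\<^sub>E UNIV)" by (rule pigeonhole)
  then obtain v w where vw: "v \<in> I \<rightarrow>\<^sub>E UNIV" "w \<in> I \<rightarrow>\<^sub>E UNIV" "\<Phi> v = \<Phi> w" "v \<noteq> w"
    by (auto simp: inj_on_def)
  obtain i where i: "i \<in> I" "v i \<noteq> w i" using vw(1,2,4) PiE_ext by metis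
  show ?thesis
  proof (rule that)
    show "i \<in> I" by fact
    show "v i - w i \<noteq> 0" using i by simp
    show "(\<Sum>i\<in>I. Polynomial.smult (v i - w i) (z i)) = 0"
      using vw(3) by (simp add: \<Phi>_def smult_diff_left sum_subtractf)
  qed
qed

lemma sum_degree_prime_divisors_le:
  fixes R :: "'f::field_gcd poly"
  assumes "R \<noteq> 0" and S: "\<And>\<pi>. \<pi> \<in> S \<Longrightarrow> prime \<pi> \<and> \<pi> dvd R"
  shows "(\<Sum>\<pi>\<in>S. degree \<pi>) \<le> degree R"
proof -
  have "(\<Sum>\<pi>\<in>S. degree \<pi>) \<le> (\<Sum>\<pi>\<in>prime_factors R. degree \<pi>)"
    using S \<open>R \<noteq> 0\<close> by (intro sum_mono2) (auto simp: in_prime_factors_iff)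
  also have "\<dots> \<le> (\<Sum>\<pi>\<in>prime_factors R. degree (\<pi> ^ multiplicity \<pi> R))"
  proof (rule sum_mono)
    fix \<pi> assume \<pi>: "\<pi> \<in> prime_factors R"
    hence "\<pi> \<noteq> 0" by auto
    moreover have "multiplicity \<pi> R \<ge> 1"
      using \<pi> \<open>R \<noteq> 0\<close> not_prime_unit[of \<pi>]
      by (intro multiplicity_geI) (auto simp: in_prime_factors_iff)
    ultimately show "degree \<pi> \<le> degree (\<pi> ^ multiplicity \<pi> R)" by (simp add: degree_power_eq)
  qed
  also have "\<dots> = degree (\<Prod>\<pi>\<in>prime_factors R. \<pi> ^ multiplicity \<pi> R)"
    by (rule degree_prod_eq_sum_degree [symmetric]) auto
  also have "\<dots> = degree R"
    using \<open>R \<noteq> 0\<close> by (simp add: prod_prime_factors)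
  finally show ?thesis .
qed

lemma geometric_sum_nat: "(q - 1) * (\<Sum>i<n. q ^ i) = q ^ n - (1 :: nat)" if "q > 0"
proof (induction n)
  case (Suc n)
  have "(q - 1) * (\<Sum>i<Suc n. q ^ i) = (q ^ n - 1) + (q - 1) * q ^ n"
    using Suc.IH by (simp add: distrib_left)
  also have "\<dots> = q ^ Suc n - 1" using that by (cases q) (auto simp: algebra_simps)
  finally show ?case .
qed auto

lemma degree_root_prod: "degree (root_prod as :: 'f::idom poly) = length as"
proof (induction as)
  case (Cons a as)
  have "root_prod as \<noteq> 0" unfolding root_prod_def by (auto simp: prod_list_zero_iff)
  thus ?case using Cons.IH by (simp add: degree_mult_eq del: mult_pCons_left)
qed auto

lemma poly_root_prod: "poly (root_prod as) x = (\<Prod>a\<leftarrow>as. a - x)"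
  by (induction as) (auto simp: algebra_simps)

text \<open>
  The core of the argument. Put \<open>q = p ^ (2 * \<mu>)\<close>, \<open>P = p ^ \<mu>\<close> and \<open>f = root_prod as\<close>. The left-hand side
  counts the \<open>\<theta>\<close> in the field with \<open>q\<close> elements at which the norm of \<open>f\<close> to \<open>F\<^sub>p\<close> is \<open>a\<close>; on average
  over \<open>a\<close> this is \<open>q / (p - 1)\<close>, and the bound exceeds this by \<open>O(sqrt q)\<close> only.

  Following Stepanov and Bombieri, a polynomial \<open>R\<close> of degree at most the right-hand side is
  constructed that vanishes at all these \<open>\<theta>\<close>. It is a combination of
  \<open>e (j, k, l) = x ^ (j * P + l) * f ^ (c * k)\<close> where \<open>c = 1 + p + \<dots> + p ^ (\<mu> - 1)\<close>. At the \<open>\<theta>\<close> in question,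
  \<open>\<theta> ^ (P * P) = \<theta>\<close> and \<open>f \<theta> ^ (c + P * c) = a\<close>. Therefore \<open>P\<close>-th powers, which fix the coefficients,
  turn \<open>e (j, k, l)\<close> into \<open>a ^ k * \<theta> ^ (l * P + j) * f \<theta> ^ (- c * k)\<close>; multiplied by \<open>f \<theta> ^ (c * m)\<close> this
  is the value of a polynomial \<open>z (j, k, l)\<close> of small degree. There are more triples
  \<open>(j, k, l)\<close> than coefficients in the \<open>z (j, k, l)\<close>, so that some nontrivial combination of the
  \<open>z (j, k, l)\<close> vanishes identically, and the same combination of the \<open>e (j, k, l)\<close> vanishes
  at \<open>\<theta>\<close>. Because \<open>0\<close> is a simple root of \<open>f\<close>, the \<open>e (j, k, l)\<close> have different orders of
  vanishing at \<open>0\<close>, and \<open>R\<close> is not the zero polynomial.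
\<close>
lemma stepanov_bound:
  fixes bs :: "'a::prime_card mod_ring list" and a :: "'a mod_ring"
  assumes p: "CARD('a) > 2" and bs: "0 \<notin> set bs" and a: "a \<noteq> 0" and \<mu>: "\<mu> \<ge> 1"
  defines "as \<equiv> 0 # bs"
  shows "(\<Sum>(\<pi>, j)\<in>{(\<pi>, j)\<in>prime_powers_of_degree (2 * \<mu>). (\<Prod>b\<leftarrow>as. poly \<pi> b) ^ j = a}. degree \<pi>)
    \<le> ((\<Sum>i<\<mu>. CARD('a) ^ i) + 3 * length as + 1) * CARD('a) ^ \<mu>"
proof -
  define p where "p = CARD('a)"
  define P where "P = p ^ \<mu>"
  define c where "c = (\<Sum>i<\<mu>. p ^ i)"
  define m where "m = p - 1"
  define d where "d = length as"
  define f where "f = root_prod as"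
  define X where "X = (monom 1 1 :: 'a mod_ring poly)"
  \<comment> \<open>The excess of \<open>J\<close> over \<open>c\<close> makes the number of triples larger than the number \<open>E\<close> of conditions.\<close>
  define J where "J = c + 2 * d + 1"
  define I where "I = {..<J} \<times> {..<m} \<times> {..<c}"
  define e where "e = (\<lambda>(j, k, l). X ^ (j * P + l) * f ^ (c * k))"
  define z where "z = (\<lambda>(j, k, l). Polynomial.smult (a ^ k) (X ^ (l * P + j) * f ^ (c * (m - k))))"
  have m2: "m \<ge> 2" using \<open>CARD('a) > 2\<close> by (simp add: m_def p_def)
  have cm: "m * c = P - 1" using geometric_sum_nat[of p \<mu>] m2 by (simp add: m_def c_def P_def)
  have P3: "P \<ge> 3"
  proof -
    have "p ^ 1 \<le> p ^ \<mu>" using \<mu> m2 by (intro power_increasing) (auto simp: m_def)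
    thus ?thesis using m2 by (simp add: P_def m_def)
  qed
  have c1: "c \<ge> 1" using cm P3 by (cases c) auto
  have cP: "2 * c \<le> P - 1" using mult_le_mono1[OF m2, of c] cm by simp
  have d1: "d \<ge> 1" by (simp add: d_def as_def)
  have degf: "degree f = d" by (simp add: f_def d_def degree_root_prod)
  have f0: "f \<noteq> 0" using degf d1 by auto
  have finI: "finite I" by (simp add: I_def)
  have cardI: "card I = J * (P - 1)" by (simp add: I_def cm)

  \<comment> \<open>A bound for the number of coefficients of the \<open>z i\<close>, i.e. for the number of linear conditions.\<close>
  define E where "E = (c - 1) * P + J + (P - 1) * d"
  have E: "E < card I"
  proof -
    obtain c' where c': "c = Suc c'" using c1 by (cases c) auto
    obtain P' where P': "P = P' + 3" using P3 by (metis add.commute le_Suc_ex)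
    obtain d' where d': "d = Suc d'" using d1 by (cases d) auto
    show ?thesis using cP unfolding E_def cardI J_def c' P' d' by (simp add: algebra_simps)
  qed
  have z_below: "z i \<in> polys_below E" if iI: "i \<in> I" for i
  proof -
    obtain j k l where i: "i = (j, k, l)" "j < J" "k < m" "l < c" using iI by (auto simp: I_def)
    have "degree (z i) \<le> l * P + j + (c * (m - k)) * d"
      unfolding i z_def X_def using f0 degf
      by (auto intro!: order_trans[OF degree_smult_le] order_trans[OF degree_mult_le]
          simp: monom_power degree_monom_eq degree_power_eq mult.commute)
    also have "\<dots> < E"
    proof -
      have "l * P \<le> (c - 1) * P" using i(4) by (intro mult_le_mono1) auto
      moreover have "(c * (m - k)) * d \<le> (P - 1) * d"
        unfolding cm[symmetric] by (intro mult_le_mono1) (simp add: mult.commute)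
      ultimately show ?thesis using i(2) unfolding E_def by linarith
    qed
    finally show ?thesis by (auto simp: polys_below_def coeff_eq_0)
  qed
  obtain w i1 where i1: "i1 \<in> I" "w i1 \<noteq> 0" and wz: "(\<Sum>i\<in>I. Polynomial.smult (w i) (z i)) = 0"
    by (rule exists_nontrivial_vanishing_combination[OF finI z_below E])
  define R where "R = (\<Sum>i\<in>I. Polynomial.smult (w i) (e i))"

  have f_eq: "f = monom 1 1 * (- root_prod bs)"
  proof -
    have "[:0, -1:] * g = monom 1 1 * (- g)" for g :: "'a mod_ring poly"
    proof (rule poly_eqI)
      fix n
      have "[:0, -1:] * g = pCons 0 (- g)"
        by (simp only: mult_pCons_left smult_0_left add_0_left smult_minus_left smult_1_left
            mult_zero_left pCons_0_0 add_0_right)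
      thus "coeff ([:0, -1:] * g) n = coeff (monom 1 1 * (- g)) n"
        by (cases n) (simp_all only: coeff_monom_mult coeff_pCons_0 coeff_pCons_Suc, simp_all)
    qed
    thus ?thesis by (simp only: f_def as_def root_prod_simps)
  qed
  have bs0: "coeff (- root_prod bs) 0 \<noteq> 0"
    using bs by (simp add: poly_0_coeff_0[symmetric] poly_root_prod prod_list_zero_iff)
  have "R \<noteq> 0"
  proof
    assume "R = 0"
    have "w i1 = 0"
    proof (rule distinct_orders_imp_independent[OF finI])
      define ord where "ord = (\<lambda>(j, k, l). j * P + (c * k + l))"
      define u where "u = (\<lambda>(j :: nat, k, l :: nat). (- root_prod bs) ^ (c * k))"
      show "inj_on ord I"
      proof (rule inj_onI)
        fix x y assume xy: "x \<in> I" "y \<in> I" "ord x = ord y"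
        obtain j k l j' k' l' where x: "x = (j, k, l)" and y: "y = (j', k', l')"
          by (metis prod.exhaust)
        have lt: "c * k + l < P" if "k < m" "l < c" for k l
        proof -
          have "c * k + l < c * (k + 1)" using that by simp
          also have "\<dots> \<le> c * m" using that by (intro mult_le_mono2) auto
          finally show ?thesis using cm P3 by (simp add: mult.commute)
        qed
        have k: "k < m" "k' < m" "l < c" "l' < c" using xy x y by (auto simp: I_def)
        have eq: "j * P + (c * k + l) = j' * P + (c * k' + l')" using xy x y by (simp add: ord_def)
        have "j = j'" using arg_cong[OF eq, of "\<lambda>n. n div P"] lt[OF k(1,3)] lt[OF k(2,4)] P3 by simp
        moreover have eq': "c * k + l = c * k' + l'" using eq calculation by simp
        moreover have "k = k'" using arg_cong[OF eq', of "\<lambda>n. n div c"] k c1 by simp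
        ultimately show "x = y" using x y by simp
      qed
      show "e i = monom 1 (ord i) * u i" for i
      proof -
        obtain j k l where i: "i = (j, k, l)" by (metis prod.exhaust)
        have "e i = monom 1 (j * P + l) * (monom 1 (c * k) * (- root_prod bs) ^ (c * k))"
          unfolding i e_def X_def case_prod_conv f_eq power_mult_distrib monom_power by simp
        also have "\<dots> = monom 1 (ord i) * u i"
          by (simp add: i ord_def u_def mult_monom add_ac flip: mult.assoc)
        finally show ?thesis .
      qed
      show "coeff (u i) 0 \<noteq> 0" for i
        using bs0 by (cases i) (simp add: u_def coeff_0_power)
    qed (use \<open>R = 0\<close> i1(1) in \<open>auto simp: R_def\<close>)
    thus False using i1(2) by simp
  qed

  have dvdR: "\<pi> dvd R"
    if x: "(\<pi>, j0) \<in> prime_powers_of_degree (2 * \<mu>)" "(\<Prod>b\<leftarrow>as. poly \<pi> b) ^ j0 = a" for \<pi> j0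
  proof -
    have \<pi>: "prime \<pi>" and j0: "j0 * degree \<pi> = 2 * \<mu>" using x by (auto simp: prime_powers_of_degree_def)
    have PP: "P * P = p ^ (j0 * degree \<pi>)" by (simp add: j0 P_def power_add mult_2)
    have XPP: "[X ^ (P * P) = X] (mod \<pi>)"
    proof -
      have "[X ^ (p ^ (j * degree \<pi>)) = X] (mod \<pi>)" for j
      proof (induction j)
        case (Suc j)
        have "X ^ (p ^ (Suc j * degree \<pi>)) = (X ^ (p ^ (j * degree \<pi>))) ^ (p ^ degree \<pi>)"
          by (simp only: power_mult[symmetric] power_add[symmetric] mult_Suc add.commute)
        also have "[\<dots> = X ^ (p ^ (j * degree \<pi>))] (mod \<pi>)"
          unfolding p_def by (rule power_card_cong[OF \<pi>])
        also note Suc.IH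
        finally show ?case .
      qed auto
      thus ?thesis unfolding PP .
    qed
    have cc: "c + P * c = (\<Sum>i<2 * \<mu>. p ^ i)"
    proof -
      have "(\<Sum>i<\<mu> + n. p ^ i) = (\<Sum>i<\<mu>. p ^ i) + (\<Sum>i<n. p ^ (\<mu> + i))" for n
        by (induction n) (auto simp: add_ac)
      thus ?thesis by (simp add: c_def P_def mult_2 power_add sum_distrib_left)
    qed
    have fcc: "[f ^ (c + P * c) = [:a:]] (mod \<pi>)"
      using norm_root_prod_cong[OF \<pi>, of as j0] x(2) unfolding cc j0 f_def p_def by simp
    \<comment> \<open>The power of \<open>f\<close> is \<open>f ^ (c * (m - k))\<close> times the \<open>k\<close>-th power of the norm \<open>f ^ (c + P * c)\<close>.\<close>
    have ez: "[f ^ (c * m) * e i ^ P = z i] (mod \<pi>)" if iI: "i \<in> I" for i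
    proof -
      obtain j k l where i: "i = (j, k, l)" "k < m" using iI by (auto simp: I_def)
      obtain m' where m': "m = k + m'" using i(2) less_imp_add_positive by blast
      have "f ^ (c * m) * e i ^ P
          = (X ^ (P * P)) ^ j * (X ^ (l * P) * (f ^ (c * (m - k)) * (f ^ (c + P * c)) ^ k))"
        unfolding i e_def m' case_prod_conv power_mult_distrib power_mult[symmetric]
        by (simp add: algebra_simps power_add)
      also have "[\<dots> = X ^ j * (X ^ (l * P) * (f ^ (c * (m - k)) * [:a:] ^ k))] (mod \<pi>)"
        by (intro cong_mult cong_pow XPP fcc cong_refl)
      also have "[:a:] ^ k = [:a ^ k:]" by (induction k) auto
      also have "X ^ j * (X ^ (l * P) * (f ^ (c * (m - k)) * [:a ^ k:])) = z i"
        by (simp add: i z_def power_add mult_ac)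
      finally show ?thesis .
    qed
    have "prime CHAR('a mod_ring poly)" "P = CHAR('a mod_ring poly) ^ \<mu>"
      by (simp_all add: P_def p_def prime_card)
    hence "R ^ P = (\<Sum>i\<in>I. Polynomial.smult (w i) (e i) ^ P)"
      unfolding R_def by (rule freshmans_dream_sum')
    also have "\<dots> = (\<Sum>i\<in>I. [:w i:] * e i ^ P)"
    proof (rule sum.cong[OF refl])
      fix i
      have "Polynomial.smult (w i) (e i) ^ P = [:w i:] ^ P * e i ^ P"
        by (simp flip: power_mult_distrib)
      also have "[:w i:] ^ P = [:w i:]" unfolding P_def p_def by (rule fermat_theorem_power_poly)
      finally show "Polynomial.smult (w i) (e i) ^ P = [:w i:] * e i ^ P" .
    qed
    finally have "f ^ (c * m) * R ^ P = (\<Sum>i\<in>I. [:w i:] * (f ^ (c * m) * e i ^ P))"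
      by (simp add: sum_distrib_left mult_ac)
    also have "[\<dots> = (\<Sum>i\<in>I. [:w i:] * z i)] (mod \<pi>)"
      by (intro cong_sum cong_mult cong_refl ez)
    also have "(\<Sum>i\<in>I. [:w i:] * z i) = 0" using wz by simp
    finally have "\<pi> dvd f ^ (c * m) * R ^ P" by (simp add: cong_0_iff)
    hence "\<pi> dvd f ^ (c * m) \<or> \<pi> dvd R ^ P" using \<pi> by (simp add: prime_dvd_mult_iff)
    moreover have "\<not> \<pi> dvd f"
    proof
      assume "\<pi> dvd f"
      hence "\<pi> dvd f ^ (c + P * c)" using c1 by (intro dvd_trans[OF _ dvd_power]) auto
      hence "\<pi> dvd [:a:]" using fcc by (simp add: cong_dvd_iff)
      hence "\<pi> dvd 1" using a by (meson dvd_trans is_unit_const_poly_iff dvd_field_iff)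
      thus False using \<pi> not_prime_unit by blast
    qed
    ultimately show ?thesis using \<pi> prime_dvd_power by blast
  qed

  define S where "S = {(\<pi>, j)\<in>prime_powers_of_degree (2 * \<mu>). (\<Prod>b\<leftarrow>as. poly \<pi> b) ^ j = a}"
  have "inj_on fst S"
    by (rule inj_on_subset[OF inj_on_fst_prime_powers_of_degree[of "2 * \<mu>"]])
       (use \<mu> in \<open>auto simp: S_def\<close>)
  hence "(\<Sum>(\<pi>, j)\<in>S. degree \<pi>) = (\<Sum>\<pi>\<in>fst ` S. degree \<pi>)"
    by (simp add: sum.reindex case_prod_unfold)
  also have "\<dots> \<le> degree R"
    using \<open>R \<noteq> 0\<close> dvdR by (intro sum_degree_prime_divisors_le)
      (auto simp: S_def prime_powers_of_degree_def)
  also have "degree R \<le> (c + 3 * d + 1) * P"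
    unfolding R_def
  proof (rule degree_sum_le[OF finI])
    fix i assume "i \<in> I"
    then obtain j k l where i: "i = (j, k, l)" "j < J" "k < m" "l < c" by (auto simp: I_def)
    have "degree (Polynomial.smult (w i) (e i)) \<le> j * P + l + (c * k) * d"
      unfolding i e_def X_def using f0 degf
      by (auto intro!: order_trans[OF degree_smult_le] order_trans[OF degree_mult_le]
          simp: monom_power degree_monom_eq degree_power_eq mult.commute)
    also have "\<dots> \<le> (c + 2 * d) * P + P + P * d"
    proof (intro add_mono)
      show "j * P \<le> (c + 2 * d) * P" using i by (intro mult_le_mono1) (simp add: J_def)
      show "l \<le> P" using i cP by simp
      have "c * k \<le> c * m" using i by simp
      also have "\<dots> \<le> P" using cm by (simp add: mult.commute)
      finally show "c * k * d \<le> P * d" by (rule mult_le_mono1)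
    qed
    also have "\<dots> = (c + 3 * d + 1) * P" by (simp add: algebra_simps)
    finally show "degree (Polynomial.smult (w i) (e i)) \<le> (c + 3 * d + 1) * P" .
  qed
  finally show ?thesis by (simp only: S_def c_def d_def P_def p_def)
qed

section \<open>Weil's bound over types of prime cardinality\<close>

lemma multiplicative_power:
  fixes \<psi> :: "'r::monoid_mult \<Rightarrow> 'c::monoid_mult"
  assumes "\<And>x y. \<psi> (x * y) = \<psi> x * \<psi> y" "\<psi> 1 = 1"
  shows "\<psi> (x ^ n) = \<psi> x ^ n"
  by (induction n) (auto simp: assms)

text \<open>
  Multiplication by \<open>u\<close> permutes the field and multiplies the sum by \<open>\<psi> u \<noteq> 1\<close>.
\<close>
lemma character_sum_eq_0:
  fixes \<psi> :: "'f::{finite,field} \<Rightarrow> 'c::idom"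
  assumes mult: "\<And>x y. \<psi> (x * y) = \<psi> x * \<psi> y" and nontriv: "u \<noteq> 0" "\<psi> u \<noteq> 1"
  shows "(\<Sum>x\<in>UNIV. \<psi> x) = 0"
proof -
  have "(\<Sum>x\<in>UNIV. \<psi> x) = (\<Sum>x\<in>UNIV. \<psi> (u * x))"
    by (rule sum.reindex_bij_witness[of _ "\<lambda>x. u * x" "\<lambda>x. x / u"]) (use nontriv in auto)
  also have "\<dots> = \<psi> u * (\<Sum>x\<in>UNIV. \<psi> x)" by (simp add: mult sum_distrib_left)
  finally have "(1 - \<psi> u) * (\<Sum>x\<in>UNIV. \<psi> x) = 0" by (simp add: algebra_simps)
  thus ?thesis using nontriv(2) by simp
qed

text \<open>
  Otherwise \<open>\<psi> x = \<psi> (x ^ CARD('f))\<close> would be larger than itself.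
\<close>
lemma norm_character_le_1:
  fixes \<psi> :: "'f::finite_field \<Rightarrow> complex"
  assumes mult: "\<And>x y. \<psi> (x * y) = \<psi> x * \<psi> y" and one: "\<psi> 1 = 1" and zero: "\<psi> 0 = 0"
  shows "cmod (\<psi> x) \<le> 1"
proof (rule ccontr)
  assume "\<not> cmod (\<psi> x) \<le> 1"
  hence gt: "cmod (\<psi> x) > 1" by simp
  have "CARD('f) > 1" using card_mono[of UNIV "{0, 1 :: 'f}"] by simp
  hence "cmod (\<psi> x) ^ 1 < cmod (\<psi> x) ^ CARD('f)"
    using gt by (intro power_strict_increasing) auto
  also have "\<dots> = cmod (\<psi> (x ^ CARD('f)))"
    by (simp only: multiplicative_power[of \<psi>, OF mult one] norm_power)
  also have "x ^ CARD('f) = x" by (rule finite_field_power_card_eq_same)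
  finally show False by simp
qed

text \<open>
  The L-function is a polynomial. Adding multiples of a polynomial \<open>l\<close> of degree less than \<open>n\<close> permutes
  the monic polynomials of degree \<open>n\<close>. If \<open>l\<close> vanishes on \<open>bs\<close> but not at \<open>a\<close>, this changes only the
  value at \<open>a\<close>, which runs through the whole field, and the sum over that value vanishes.
\<close>
lemma sum_monics_character_eq_0:
  fixes \<psi> :: "'f::{finite,field} \<Rightarrow> complex"
  assumes mult: "\<And>x y. \<psi> (x * y) = \<psi> x * \<psi> y" and nontriv: "u \<noteq> 0" "\<psi> u \<noteq> 1"
    and bs: "a \<notin> set bs" and n: "n > card (set bs)"
  shows "(\<Sum>g\<in>monics n. \<psi> (\<Prod>b\<leftarrow>a # bs. poly g b)) = 0"
proof -
  \<comment> \<open>Removing repetitions makes the number of distinct roots decisive.\<close>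
  define l where "l = root_prod (remdups bs)"
  define v where "v = poly l a"
  have v: "v \<noteq> 0" using bs by (auto simp: v_def l_def poly_root_prod prod_list_zero_iff)
  have l_bs: "poly l b = 0" if "b \<in> set bs" for b
    using that by (auto simp: l_def poly_root_prod prod_list_zero_iff)
  have degl: "degree l < n" using n by (simp add: l_def degree_root_prod length_remdups_card_conv)
  have mon: "g + Polynomial.smult t l \<in> monics n" if "g \<in> monics n" for g t
  proof -
    have "degree (Polynomial.smult t l) < degree g"
      using that degl by (auto simp: monics_def intro: le_less_trans[OF degree_smult_le])
    hence "degree (g + Polynomial.smult t l) = degree g" by (rule degree_add_eq_left)
    thus ?thesis using that degl by (simp add: monics_def coeff_eq_0)
  qed
  have shift: "(\<Sum>g\<in>monics n. \<psi> (\<Prod>b\<leftarrow>a # bs. poly g b))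
      = (\<Sum>g\<in>monics n. \<psi> (poly g a + t * v) * \<psi> (\<Prod>b\<leftarrow>bs. poly g b))" for t
  proof -
    have "(\<Sum>g\<in>monics n. \<psi> (\<Prod>b\<leftarrow>a # bs. poly g b))
        = (\<Sum>g\<in>monics n. \<psi> (\<Prod>b\<leftarrow>a # bs. poly (g + Polynomial.smult t l) b))"
    proof (rule sum.reindex_bij_witness[of _ "\<lambda>g. g + Polynomial.smult t l" "\<lambda>g. g + Polynomial.smult (- t) l"], goal_cases)
      case (2 g) thus ?case using mon[of g "-t"] by simp
    next
      case (4 g) thus ?case using mon[of g t] by simp
    qed simp_all
    also have "\<dots> = (\<Sum>g\<in>monics n. \<psi> (poly g a + t * v) * \<psi> (\<Prod>b\<leftarrow>bs. poly g b))"
    proof (rule sum.cong[OF refl])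
      fix g :: "'f poly"
      have "map (poly (g + Polynomial.smult t l)) bs = map (poly g) bs"
        by (intro map_cong refl) (simp add: l_bs)
      thus "\<psi> (\<Prod>b\<leftarrow>a # bs. poly (g + Polynomial.smult t l) b)
          = \<psi> (poly g a + t * v) * \<psi> (\<Prod>b\<leftarrow>bs. poly g b)"
        by (simp add: mult v_def del: map_eq_conv poly_add)
           (simp add: v_def)
    qed
    finally show ?thesis .
  qed
  have "of_nat CARD('f) * (\<Sum>g\<in>monics n. \<psi> (\<Prod>b\<leftarrow>a # bs. poly g b))
      = (\<Sum>t\<in>(UNIV :: 'f set). \<Sum>g\<in>monics n. \<psi> (\<Prod>b\<leftarrow>a # bs. poly g b))" by simp
  also have "\<dots> = (\<Sum>t\<in>UNIV. \<Sum>g\<in>monics n. \<psi> (poly g a + t * v) * \<psi> (\<Prod>b\<leftarrow>bs. poly g b))"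
    by (rule sum.cong[OF refl]) (rule shift)
  also have "\<dots> = (\<Sum>g\<in>monics n. \<Sum>t\<in>UNIV. \<psi> (poly g a + t * v) * \<psi> (\<Prod>b\<leftarrow>bs. poly g b))"
    by (rule sum.swap)
  also have "\<dots> = (\<Sum>g\<in>monics n. (\<Sum>t\<in>UNIV. \<psi> (poly g a + t * v)) * \<psi> (\<Prod>b\<leftarrow>bs. poly g b))"
    by (simp add: sum_distrib_right)
  also have "\<dots> = (\<Sum>g\<in>monics n. (\<Sum>y\<in>UNIV. \<psi> y) * \<psi> (\<Prod>b\<leftarrow>bs. poly g b))"
  proof (rule sum.cong[OF refl], rule arg_cong2[where f = "(*)"])
    fix g :: "'f poly"
    show "(\<Sum>t\<in>UNIV. \<psi> (poly g a + t * v)) = (\<Sum>y\<in>UNIV. \<psi> y)"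
      by (rule sum.reindex_bij_witness[of _ "\<lambda>y. (y - poly g a) / v" "\<lambda>t. poly g a + t * v"])
         (use v in auto)
  qed auto
  also have "\<dots> = 0" using character_sum_eq_0[of \<psi>, OF mult nontriv] by simp
  finally show ?thesis by simp
qed

text \<open>
  Stepanov's method bounds the number \<open>N y\<close> of field elements with norm \<open>y\<close> from above only. The total
  number is known exactly, so the deficits \<open>U - N y\<close> from the upper bound \<open>U\<close> are small in the
  mean, and \<open>U\<close> itself may be subtracted from each \<open>N y\<close> as the character sums to \<open>0\<close>.
\<close>
lemma prime_power_sum_character_bound:
  fixes \<psi> :: "'a::prime_card mod_ring \<Rightarrow> complex"
  assumes mult: "\<And>x y. \<psi> (x * y) = \<psi> x * \<psi> y" and one: "\<psi> 1 = 1" and zero: "\<psi> 0 = 0"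
    and nontriv: "u \<noteq> 0" "\<psi> u \<noteq> 1"
    and p: "CARD('a) > 2" and bs: "0 \<notin> set bs" and \<mu>: "\<mu> \<ge> 1"
  defines "as \<equiv> 0 # bs"
  shows "cmod (prime_power_sum (\<lambda>g. \<psi> (\<Prod>a\<leftarrow>as. poly g a)) (2 * \<mu>))
    \<le> real ((CARD('a) - 1) * (3 * length as + 1) + length as) * real CARD('a) ^ \<mu>"
proof -
  define p where "p = CARD('a)"
  define P where "P = p ^ \<mu>"
  define c where "c = (\<Sum>i<\<mu>. p ^ i)"
  define m where "m = p - 1"
  define d where "d = length as"
  define B where "B = (prime_powers_of_degree (2 * \<mu>) :: ('a mod_ring poly \<times> nat) set)"
  define \<rho> where "\<rho> = (\<lambda>(\<pi>, j). (\<Prod>a\<leftarrow>as. poly \<pi> a) ^ j :: 'a mod_ring)"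
  define N where "N = (\<lambda>y. \<Sum>(\<pi>, j)\<in>{x\<in>B. \<rho> x = y}. degree \<pi>)"
  define U where "U = (c + 3 * d + 1) * P"
  have finB: "finite B" unfolding B_def by (rule finite_prime_powers_of_degree)
  have P1: "P \<ge> 1" using p by (simp add: P_def p_def)
  have NU: "N y \<le> U" if "y \<noteq> 0" for y
    using stepanov_bound[OF p bs that \<mu>]
    by (simp add: N_def U_def B_def \<rho>_def c_def P_def p_def d_def as_def case_prod_unfold)
  have "(\<Sum>y\<in>UNIV. N y) = (\<Sum>x\<in>B. degree (fst x))"
    unfolding N_def case_prod_unfold by (rule sum.group) (use finB in auto)
  also have "\<dots> = p ^ (2 * \<mu>)"
    using prime_power_sum_trivial[where 'f = "'a mod_ring", of "2 * \<mu>"] \<mu>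
    by (simp add: prime_power_sum_def B_def p_def case_prod_unfold)
  also have "\<dots> = P * P" by (simp add: P_def mult_2 power_add)
  finally have N_total: "(\<Sum>y\<in>UNIV. N y) = P * P" .
  have N0: "N 0 \<le> d"
  proof -
    define S where "S = {x\<in>B. \<rho> x = 0}"
    have "inj_on fst S"
      by (rule inj_on_subset[OF inj_on_fst_prime_powers_of_degree[of "2 * \<mu>"]])
         (use \<mu> in \<open>auto simp: S_def B_def\<close>)
    hence "N 0 = (\<Sum>\<pi>\<in>fst ` S. degree \<pi>)"
      by (simp add: N_def S_def sum.reindex case_prod_unfold)
    also have "\<dots> \<le> degree (root_prod as)"
    proof (rule sum_degree_prime_divisors_le)
      have "degree (root_prod as) > 0" by (simp only: degree_root_prod) (simp add: as_def)
      thus "root_prod as \<noteq> 0" by auto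
      fix \<pi> assume "\<pi> \<in> fst ` S"
      then obtain j where x: "(\<pi>, j) \<in> B" "\<rho> (\<pi>, j) = 0" by (auto simp: S_def)
      have \<pi>: "prime \<pi>" using x by (auto simp: B_def prime_powers_of_degree_def)
      from x(2) obtain a where a: "a \<in> set as" "poly \<pi> a = 0"
        by (auto simp: \<rho>_def prod_list_zero_iff)
      have dvd: "[:-a, 1:] dvd \<pi>" using a(2) by (simp add: poly_eq_0_iff_dvd)
      have "irreducible \<pi>" using \<pi> by (intro prime_elem_imp_irreducible) auto
      moreover have "\<not> is_unit [:-a, 1:]" by (simp add: is_unit_iff_degree)
      ultimately have "\<pi> dvd [:-a, 1:]" using irreducibleD'[OF _ dvd] by blast
      also have "[:-a, 1:] dvd root_prod as"
        using a(1) unfolding poly_eq_0_iff_dvd [symmetric] poly_root_prod prod_list_zero_iff by force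
      finally show "prime \<pi> \<and> \<pi> dvd root_prod as" using \<pi> by blast
    qed
    finally show ?thesis by (simp add: degree_root_prod d_def)
  qed
  have "prime_power_sum (\<lambda>g. \<psi> (\<Prod>a\<leftarrow>as. poly g a)) (2 * \<mu>) = (\<Sum>x\<in>B. of_nat (degree (fst x)) * \<psi> (\<rho> x))"
    by (simp add: prime_power_sum_def B_def \<rho>_def case_prod_unfold multiplicative_power[of \<psi>, OF mult one])
  also have "\<dots> = (\<Sum>y\<in>UNIV. \<Sum>x\<in>{x\<in>B. \<rho> x = y}. of_nat (degree (fst x)) * \<psi> (\<rho> x))"
    by (rule sum.group[symmetric]) (use finB in auto)
  also have "\<dots> = (\<Sum>y\<in>UNIV. of_nat (N y) * \<psi> y)"
    by (rule sum.cong[OF refl]) (simp add: N_def case_prod_unfold sum_distrib_right)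
  \<comment> \<open>The constant \<open>U\<close> is orthogonal to the character.\<close>
  also have "\<dots> = (\<Sum>y\<in>UNIV. of_nat (N y) * \<psi> y) - of_nat U * (\<Sum>y\<in>UNIV. \<psi> y)"
    using character_sum_eq_0[of \<psi>, OF mult nontriv] by simp
  also have "\<dots> = (\<Sum>y\<in>UNIV. (of_nat (N y) - of_nat U) * \<psi> y)"
    by (simp add: sum_distrib_left sum_subtractf algebra_simps)
  also have "\<dots> = (\<Sum>y\<in>UNIV-{0}. (of_nat (N y) - of_nat U) * \<psi> y)"
    by (rule sum.mono_neutral_right) (auto simp: zero)
  finally have "cmod (prime_power_sum (\<lambda>g. \<psi> (\<Prod>a\<leftarrow>as. poly g a)) (2 * \<mu>))
      \<le> (\<Sum>y\<in>UNIV-{0}. cmod ((of_nat (N y) - of_nat U) * \<psi> y))"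
    by (simp only: norm_sum)
  also have "\<dots> \<le> (\<Sum>y\<in>UNIV-{0}. real U - real (N y))"
  proof (rule sum_mono)
    fix y :: "'a mod_ring" assume y: "y \<in> UNIV - {0}"
    have "cmod (of_nat (N y) - of_nat U) = real U - real (N y)"
      using NU[of y] y by (metis Diff_iff insertI1 norm_minus_commute norm_of_nat of_nat_diff)
    moreover have "cmod (\<psi> y) \<le> 1" by (rule norm_character_le_1[of \<psi>, OF mult one zero])
    ultimately show "cmod ((of_nat (N y) - of_nat U) * \<psi> y) \<le> real U - real (N y)"
      using NU[of y] y by (simp add: norm_mult mult_left_le)
  qed
  also have "\<dots> = real m * real U - (real (P * P) - real (N 0))"
  proof -
    have "(\<Sum>y\<in>UNIV. N y) = N 0 + (\<Sum>y\<in>UNIV-{0}. N y)" by (simp add: sum.remove)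
    hence "real (P * P) = real (N 0) + (\<Sum>y\<in>UNIV-{0}. real (N y))"
      unfolding N_total by (metis of_nat_add of_nat_sum)
    moreover have "card (UNIV - {0 :: 'a mod_ring}) = m" by (simp add: m_def p_def)
    ultimately show ?thesis by (simp add: sum_subtractf)
  qed
  also have "\<dots> \<le> real ((m * (3 * d + 1) + d) * P)"
  proof -
    have "m * c = P - 1" using geometric_sum_nat[of p \<mu>] p by (simp add: m_def c_def P_def p_def)
    moreover have "m * U = (m * c) * P + m * (3 * d + 1) * P" by (simp add: U_def algebra_simps)
    ultimately have "m * U = (P - 1) * P + m * (3 * d + 1) * P" by (simp only:)
    also have "\<dots> \<le> P * P + m * (3 * d + 1) * P" by (simp add: mult_le_mono1)
    finally have "m * U \<le> P * P + m * (3 * d + 1) * P" .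
    moreover have "N 0 \<le> d * P" using N0 P1 mult_le_mono[of "N 0" d 1 P] by simp
    ultimately have "m * U + N 0 \<le> P * P + (m * (3 * d + 1) + d) * P" by (simp add: algebra_simps)
    hence "real (m * U + N 0) \<le> real (P * P + (m * (3 * d + 1) + d) * P)" by (simp only: of_nat_le_iff)
    thus ?thesis by simp
  qed
  finally show ?thesis by (simp add: m_def p_def d_def P_def)
qed

text \<open>
  The monic polynomials of degree \<open>1\<close> are \<open>T - x\<close>, so the first coefficient of the L-function is
  the character sum in question.
\<close>
lemma weil_bound_root_at_0:
  fixes \<psi> :: "'a::prime_card mod_ring \<Rightarrow> complex"
  assumes mult: "\<And>x y. \<psi> (x * y) = \<psi> x * \<psi> y" and one: "\<psi> 1 = 1" and zero: "\<psi> 0 = 0"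
    and nontriv: "u \<noteq> 0" "\<psi> u \<noteq> 1" and p: "CARD('a) > 2" and bs: "0 \<notin> set bs"
  shows "cmod (\<Sum>x\<in>UNIV. \<psi> (\<Prod>a\<leftarrow>0 # bs. a - x)) \<le> real (card (set bs) + 1) * sqrt (real CARD('a))"
proof -
  define F where "F = (\<lambda>g. \<psi> (\<Prod>a\<leftarrow>0 # bs. poly g a))"
  have F_mult: "F (g * h) = F g * F h" for g h
  proof -
    have "(\<Prod>a\<leftarrow>as. poly (g * h) a) = (\<Prod>a\<leftarrow>as. poly g a) * (\<Prod>a\<leftarrow>as. poly h a)" for as
      by (induction as) auto
    thus ?thesis by (simp only: F_def mult)
  qed
  have F_one: "F 1 = 1"
  proof -
    have "(\<Prod>a\<leftarrow>as. poly 1 a) = (1 :: 'a mod_ring)" for as by (induction as) auto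
    thus ?thesis by (simp only: F_def one)
  qed
  have "cmod (\<Sum>g\<in>monics 1. F g) \<le> real (card (set bs) + 1) * sqrt (real CARD('a))"
  proof (rule newton_recurrence_first_coeff_bound[where c = "\<lambda>n. \<Sum>g\<in>monics n. F g" and s = "prime_power_sum F"])
    show "(\<Sum>g\<in>monics 0. F g) = 1" by (simp add: monics_0 F_one)
    show "(\<Sum>g\<in>monics n. F g) = 0" if "n \<ge> card (set bs) + 1" for n
      unfolding F_def by (rule sum_monics_character_eq_0[of \<psi>, OF mult nontriv bs]) (use that in auto)
    show "of_nat n * (\<Sum>g\<in>monics n. F g)
        = (\<Sum>k=1..n. prime_power_sum F k * (\<Sum>g\<in>monics (n - k). F g))" for n
      by (rule newton_recurrence_monics[of F, OF F_mult F_one])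
    show "cmod (prime_power_sum F (2 * k))
        \<le> real ((CARD('a) - 1) * (3 * length (0 # bs) + 1) + length (0 # bs)) * real CARD('a) ^ k"
      if "k \<ge> 1" for k
      unfolding F_def by (rule prime_power_sum_character_bound[of \<psi>, OF mult one zero nontriv p bs that])
    show "real CARD('a) > 0" by simp
  qed
  moreover have "(\<Sum>g\<in>monics 1. F g) = (\<Sum>x\<in>UNIV. F [:-x, 1:])"
  proof (rule sum.reindex_bij_witness[of _ "\<lambda>x. [:-x, 1:]" "\<lambda>g. - coeff g 0"])
    fix g :: "'a mod_ring poly" assume "g \<in> monics 1"
    hence "degree g = 1" "coeff g 1 = 1" by (auto simp: monics_def)
    thus "[:- (- coeff g 0), 1:] = g"
      by (intro poly_eqI) (auto simp: coeff_pCons coeff_eq_0 split: nat.split)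
    thus "F [:- (- coeff g 0), 1:] = F g" by (rule arg_cong)
  qed (auto simp: monics_def)
  moreover have "poly [:-x, 1:] = (\<lambda>a. a - x)" for x :: "'a mod_ring"
    by (simp add: fun_eq_iff)
  ultimately show ?thesis by (simp only: F_def)
qed

text \<open>
  A translation moves the simple root to \<open>0\<close>, and the existence of \<open>u\<close> excludes \<open>p = 2\<close>.
\<close>
lemma weil_bound_simple_root:
  fixes \<psi> :: "'a::prime_card mod_ring \<Rightarrow> complex"
  assumes mult: "\<And>x y. \<psi> (x * y) = \<psi> x * \<psi> y" and one: "\<psi> 1 = 1" and zero: "\<psi> 0 = 0"
    and nontriv: "u \<noteq> 0" "\<psi> u \<noteq> 1" and bs: "a \<notin> set bs"
  shows "cmod (\<Sum>x\<in>UNIV. \<psi> (\<Prod>b\<leftarrow>a # bs. b - x)) \<le> real (card (set bs) + 1) * sqrt (real CARD('a))"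
proof -
  have p: "CARD('a) > 2"
  proof -
    have "u \<noteq> 1" using nontriv one by auto
    hence "card {0, 1, u} = 3" using nontriv by simp
    moreover have "card {0, 1, u} \<le> CARD('a mod_ring)" by (rule card_mono) auto
    ultimately show ?thesis by simp
  qed
  have "(\<Sum>x\<in>UNIV. \<psi> (\<Prod>b\<leftarrow>a # bs. b - x))
      = (\<Sum>x\<in>UNIV. \<psi> (\<Prod>b\<leftarrow>0 # map (\<lambda>b. b - a) bs. b - x))"
    by (rule sum.reindex_bij_witness[of _ "\<lambda>x. x + a" "\<lambda>x. x - a"])
       (auto simp: o_def algebra_simps)
  also have "cmod \<dots> \<le> real (card (set (map (\<lambda>b. b - a) bs)) + 1) * sqrt (real CARD('a))"
    using bs by (intro weil_bound_root_at_0[of \<psi>, OF mult one zero nontriv p]) auto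
  also have "card (set (map (\<lambda>b. b - a) bs)) = card (set bs)"
    by (simp add: card_image inj_on_def)
  finally show ?thesis .
qed

section \<open>Weil's bound for Dirichlet characters\<close>

text \<open>
  Weil's bound for the character sums modulo \<open>p\<close> that have a zero \<open>a\<close> of multiplicity exactly one. It is
  stated as a property of the modulus because the modulus is going to be chosen by a condition on
  this property.
\<close>
definition weil_bound_mod :: "nat \<Rightarrow> bool" where
  "weil_bound_mod p \<longleftrightarrow> (\<forall>chi a ds es. dirichlet_char p chi \<longrightarrow> chi \<noteq> principal_char p \<longrightarrow>
     (\<forall>b\<in>set ds \<union> set es. \<not> [b = a] (mod int p)) \<longrightarrow>
     cmod (\<Sum>x\<in>{0..<int p}. chi (a - x) * (\<Prod>b\<leftarrow>ds. chi (b - x)) * (\<Prod>b\<leftarrow>es. cnj (chi (b - x))))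
       \<le> real (length ds + length es + 1) * sqrt (real p))"

lemma dirichlet_charD:
  assumes "dirichlet_char p chi"
  shows "chi (k * l) = chi k * chi l" "[k = l] (mod int p) \<Longrightarrow> chi k = chi l"
    "chi k = 0 \<longleftrightarrow> \<not> algebraic_semidom_class.coprime k (int p)"
  using assms unfolding dirichlet_char_def by blast+

lemma of_int_mod_ring_eq_iff:
  "(of_int k = (of_int l :: 'a::nontriv mod_ring)) \<longleftrightarrow> [k = l] (mod int CARD('a))"
  unfolding of_int_of_int_mod_ring by transfer (simp add: unique_euclidean_semiring_class.cong_def)

lemma bij_betw_of_int_mod_ring:
  "bij_betw (of_int :: int \<Rightarrow> 'a::nontriv mod_ring) {0..<int CARD('a)} UNIV"
  by (rule bij_betwI[where g = to_int_mod_ring])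
     (use range_to_int_mod_ring[where 'a = 'a] in \<open>auto simp: of_int_of_int_mod_ring\<close>)

text \<open>
  Nonzero values lie on the unit circle, so conjugation inverts them, and inversion is the power
  with exponent \<open>p - 2\<close>. Conjugated factors thus become factors of a single polynomial; its degree is
  of the order of \<open>p\<close>, but it has few distinct roots.
\<close>
lemma cnj_character:
  fixes \<psi> :: "'a::prime_card mod_ring \<Rightarrow> complex"
  assumes mult: "\<And>x y. \<psi> (x * y) = \<psi> x * \<psi> y" and one: "\<psi> 1 = 1" and zero: "\<psi> 0 = 0"
    and p: "CARD('a) > 2"
  shows "cnj (\<psi> x) = \<psi> (x ^ (CARD('a) - 2))"
proof (cases "x = 0")
  case False
  have "CARD('a) = Suc (CARD('a) - 2 + 1)" using p by simp
  hence "x ^ (CARD('a) - 2) * x * x = x"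
    using fermat_theorem_mod_ring[of x] by (metis Suc_eq_plus1 mult.commute power_Suc)
  hence inv: "x ^ (CARD('a) - 2) * x = 1" using False by simp
  have le1: "cmod (\<psi> y) \<le> 1" for y by (rule norm_character_le_1[of \<psi>, OF mult one zero])
  have prod1: "\<psi> (x ^ (CARD('a) - 2)) * \<psi> x = 1" using inv by (metis mult one)
  hence "cmod (\<psi> (x ^ (CARD('a) - 2))) * cmod (\<psi> x) = 1" by (metis norm_mult norm_one)
  moreover have "cmod (\<psi> (x ^ (CARD('a) - 2))) * cmod (\<psi> x) \<le> cmod (\<psi> x)"
    using le1[of "x ^ (CARD('a) - 2)"] by (intro mult_left_le_one_le) auto
  ultimately have "cmod (\<psi> x) = 1" using le1[of x] by linarith
  hence "cnj (\<psi> x) * \<psi> x = 1" by (simp add: mult.commute flip: complex_norm_square)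
  thus ?thesis using prod1 by (metis mult_cancel_right mult_zero_right zero_neq_one)
next
  case True
  have "0 ^ (CARD('a) - 2) = (0 :: 'a mod_ring)" using p by (intro zero_power) simp
  thus ?thesis using True zero by (simp only: complex_cnj_zero)
qed

lemma weil_bound_mod_CARD: "weil_bound_mod CARD('a::prime_card)"
  unfolding weil_bound_mod_def
proof (intro allI impI)
  fix chi a ds es
  assume chi: "dirichlet_char CARD('a) chi" "chi \<noteq> principal_char CARD('a)"
    and a: "\<forall>b\<in>set ds \<union> set es. \<not> [b = a] (mod int CARD('a))"
  define p where "p = CARD('a)"
  define \<psi> where "\<psi> = (\<lambda>x :: 'a mod_ring. chi (to_int_mod_ring x))"
  have chi_eq: "chi k = \<psi> (of_int k)" for k
    unfolding \<psi>_def
  proof (rule dirichlet_charD(2)[OF chi(1)])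
    have "of_int k = (of_int (to_int_mod_ring (of_int k :: 'a mod_ring)) :: 'a mod_ring)"
      by (simp add: of_int_of_int_mod_ring)
    thus "[k = to_int_mod_ring (of_int k :: 'a mod_ring)] (mod int CARD('a))"
      by (simp only: of_int_mod_ring_eq_iff)
  qed
  have surj: "\<exists>k. x = of_int k" for x :: "'a mod_ring"
    by (rule exI[of _ "to_int_mod_ring x"]) (simp add: of_int_of_int_mod_ring)
  have mult: "\<psi> (x * y) = \<psi> x * \<psi> y" for x y
  proof -
    obtain k l where kl: "x = of_int k" "y = of_int l" using surj by blast
    show ?thesis unfolding kl of_int_mult [symmetric] chi_eq [symmetric]
      by (rule dirichlet_charD(1)[OF chi(1)])
  qed
  have zero: "\<psi> 0 = 0"
    using dirichlet_charD(3)[OF chi(1), of 0] prime_card[where 'a = 'a]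
    by (auto simp: chi_eq not_prime_unit[of "CARD('a)"] prime_gt_1_nat)
  have nz1: "\<psi> 1 \<noteq> 0" using dirichlet_charD(3)[OF chi(1), of 1] by (simp add: chi_eq)
  have one: "\<psi> 1 = 1" using mult[of 1 1] nz1 by simp
  obtain k where k: "chi k \<noteq> principal_char CARD('a) k" using chi(2) by blast
  have cop: "algebraic_semidom_class.coprime k (int CARD('a))"
    using k dirichlet_charD(3)[OF chi(1), of k] by (auto simp: principal_char_def split: if_splits)
  define u where "u = (of_int k :: 'a mod_ring)"
  have u: "u \<noteq> 0" "\<psi> u \<noteq> 1"
    using k cop dirichlet_charD(3)[OF chi(1), of k] zero
    by (auto simp: u_def principal_char_def chi_eq)
  have p2: "CARD('a) > 2"
  proof -
    have "u \<noteq> 1" using u one by auto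
    hence "card {0, 1, u} = 3" using u by simp
    moreover have "card {0, 1, u} \<le> CARD('a mod_ring)" by (rule card_mono) auto
    ultimately show ?thesis by simp
  qed
  define bs :: "'a mod_ring list" where "bs = map of_int ds @ concat (map (\<lambda>b. replicate (CARD('a) - 2) (of_int b)) es)"
  have set_bs: "set bs = (of_int :: int \<Rightarrow> 'a mod_ring) ` (set ds \<union> set es)"
    using p2 by (auto simp: bs_def)
  have notin: "of_int a \<notin> set bs"
    using a unfolding set_bs by (auto simp: of_int_mod_ring_eq_iff cong_sym_eq)
  have term_eq: "chi (a - x) * (\<Prod>b\<leftarrow>ds. chi (b - x)) * (\<Prod>b\<leftarrow>es. cnj (chi (b - x)))
      = \<psi> (\<Prod>b\<leftarrow>of_int a # bs. b - of_int x)" for x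
  proof -
    have 1: "\<psi> (\<Prod>b\<leftarrow>bs. b - of_int x) = (\<Prod>b\<leftarrow>bs. \<psi> (b - of_int x))" for bs
      by (induction bs) (simp_all add: mult one)
    have 2: "(\<Prod>b\<leftarrow>concat (map (\<lambda>b. replicate n (of_int b)) es). \<psi> (b - of_int x))
        = (\<Prod>b\<leftarrow>es. \<psi> (of_int b - of_int x) ^ n)" for n
      by (induction es) (simp_all add: prod_list_replicate)
    have 3: "cnj (\<psi> y) = \<psi> y ^ (CARD('a) - 2)" for y
      using cnj_character[of \<psi>, OF mult one zero p2] multiplicative_power[of \<psi>, OF mult one] by simp
    show ?thesis
      unfolding 1[of "of_int a # bs"] by (simp add: bs_def 2 chi_eq 3 o_def mult_ac)
  qed
  have "(\<Sum>x\<in>{0..<int CARD('a)}. chi (a - x) * (\<Prod>b\<leftarrow>ds. chi (b - x)) * (\<Prod>b\<leftarrow>es. cnj (chi (b - x))))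
      = (\<Sum>x\<in>UNIV. \<psi> (\<Prod>b\<leftarrow>of_int a # bs. b - x))"
    unfolding term_eq by (rule sum.reindex_bij_betw[OF bij_betw_of_int_mod_ring])
  also have "cmod \<dots> \<le> real (card (set bs) + 1) * sqrt (real CARD('a))"
    by (rule weil_bound_simple_root[of \<psi>, OF mult one zero u notin])
  also have "\<dots> \<le> real (length ds + length es + 1) * sqrt (real CARD('a))"
  proof -
    have "card (set bs) \<le> card (set ds \<union> set es)" unfolding set_bs by (rule card_image_le) simp
    also have "\<dots> \<le> card (set ds) + card (set es)" by (rule card_Un_le)
    also have "\<dots> \<le> length ds + length es" by (intro add_mono card_length)
    finally show ?thesis by (intro mult_right_mono) auto
  qed
  finally show "cmod (\<Sum>x\<in>{0..<int CARD('a)}. chi (a - x) * (\<Prod>b\<leftarrow>ds. chi (b - x)) * (\<Prod>b\<leftarrow>es. cnj (chi (b - x))))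
      \<le> real (length ds + length es + 1) * sqrt (real CARD('a))" .
qed

text \<open>
  The results above concern a type of prime cardinality, and a type cannot depend on a variable \<open>p\<close>.
  It is enough to treat one fixed prime: one that violates the bound, if such a prime exists. A type
  of this cardinality can be defined, the bound holds for it, so there is no violating prime.
  The value \<open>2\<close> only serves to make the constant a prime in any case.
\<close>
definition critical_prime :: nat where
  "critical_prime = (if \<exists>p. prime p \<and> \<not> weil_bound_mod p then SOME p. prime p \<and> \<not> weil_bound_mod p else 2)"

lemma prime_critical_prime: "prime critical_prime"
  unfolding critical_prime_def by (auto intro: someI2_ex)

typedef critical_index = "{..<critical_prime}"
  using prime_gt_0_nat[OF prime_critical_prime] by blast

lemma CARD_critical_index: "CARD(critical_index) = critical_prime"
  using type_definition.card[OF type_definition_critical_index] by simp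

instance critical_index :: prime_card
  by standard (simp add: CARD_critical_index prime_critical_prime)

lemma weil_bound:
  assumes "prime p" "dirichlet_char p chi" "chi \<noteq> principal_char p"
    and "\<And>b. b \<in> set ds \<union> set es \<Longrightarrow> \<not> [b = a] (mod int p)"
  shows "cmod (\<Sum>x\<in>{0..<int p}. chi (a - x) * (\<Prod>b\<leftarrow>ds. chi (b - x)) * (\<Prod>b\<leftarrow>es. cnj (chi (b - x))))
    \<le> real (length ds + length es + 1) * sqrt (real p)"
proof -
  have "weil_bound_mod p"
  proof (rule ccontr)
    assume "\<not> weil_bound_mod p"
    hence ex: "\<exists>p. prime p \<and> \<not> weil_bound_mod p" using \<open>prime p\<close> by blast
    hence "\<not> weil_bound_mod critical_prime"
      unfolding critical_prime_def using someI_ex[OF ex] by simp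
    thus False using weil_bound_mod_CARD[where 'a = critical_index] by (simp add: CARD_critical_index)
  qed
  thus ?thesis unfolding weil_bound_mod_def using assms(2-4) by blast
qed

section \<open>Moments of character sums\<close>

text \<open>
  The powers of \<open>chi k\<close> are values of \<open>chi\<close> and so remain in a finite set.
\<close>
lemma norm_dirichlet_char_le_1:
  assumes chi: "dirichlet_char p chi" and p: "p > 0"
  shows "cmod (chi k) \<le> 1"
proof (rule ccontr)
  assume "\<not> cmod (chi k) \<le> 1"
  hence gt: "cmod (chi k) > 1" by simp
  define V where "V = (\<lambda>x. cmod (chi x)) ` {0..<int p}"
  have fin: "finite V" by (simp add: V_def)
  obtain n where n: "Max V < cmod (chi k) ^ n" using real_arch_pow[OF gt] by blast
  have pow: "chi (k ^ Suc m) = chi k ^ Suc m" for m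
    by (induction m) (simp_all add: dirichlet_charD(1)[OF chi])
  have "chi (k ^ Suc n) = chi (k ^ Suc n mod int p)"
    by (rule dirichlet_charD(2)[OF chi]) (simp add: unique_euclidean_semiring_class.cong_def del: power_Suc)
  hence "cmod (chi k) ^ Suc n = cmod (chi (k ^ Suc n mod int p))" by (simp only: pow norm_power [symmetric])
  moreover have "k ^ Suc n mod int p \<in> {0..<int p}" using p by (simp del: power_Suc)
  ultimately have "cmod (chi k) ^ Suc n \<in> V" unfolding V_def by blast
  hence "cmod (chi k) ^ Suc n \<le> Max V" using fin by simp
  moreover have "cmod (chi k) ^ n \<le> cmod (chi k) ^ Suc n" using gt by (intro power_increasing) auto
  ultimately show False using n by linarith
qed

lemma power_sum_eq_sum_lists:
  fixes h :: "'i \<Rightarrow> 'c::comm_semiring_1"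
  assumes "finite D"
  shows "(\<Sum>d\<in>D. h d) ^ n = (\<Sum>xs | set xs \<subseteq> D \<and> length xs = n. \<Prod>d\<leftarrow>xs. h d)"
proof (induction n)
  case 0
  have "{xs. set xs \<subseteq> D \<and> length xs = 0} = {[]}" by auto
  thus ?case by simp
next
  case (Suc n)
  let ?L = "\<lambda>n. {xs. set xs \<subseteq> D \<and> length xs = n}"
  have "(\<Sum>d\<in>D. h d) ^ Suc n = (\<Sum>d\<in>D. \<Sum>xs\<in>?L n. h d * (\<Prod>d\<leftarrow>xs. h d))"
    by (simp add: Suc.IH sum_product)
  also have "\<dots> = (\<Sum>(d, xs)\<in>D \<times> ?L n. \<Prod>d\<leftarrow>d # xs. h d)"
    by (simp add: sum.cartesian_product)
  also have "\<dots> = (\<Sum>xs\<in>?L (Suc n). \<Prod>d\<leftarrow>xs. h d)"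
    by (rule sum.reindex_bij_witness[of _ "\<lambda>xs. (hd xs, tl xs)" "\<lambda>(d, xs). d # xs"])
       (auto simp: length_Suc_conv)
  finally show ?case .
qed

text \<open>
  Such a list has at most \<open>n\<close> distinct elements. It is described by a list of \<open>n\<close> letters and
  \<open>2 * n\<close> indices into this list.
\<close>
lemma card_lists_without_unique_element:
  assumes "finite D"
  shows "card {xs. set xs \<subseteq> D \<and> length xs = 2 * n \<and> (\<forall>x\<in>set xs. count_list xs x \<noteq> 1)}
    \<le> n ^ (2 * n) * card D ^ n" (is "card ?S \<le> _")
proof -
  let ?Y = "{ys. set ys \<subseteq> D \<and> length ys = n}" and ?H = "{hs. set hs \<subseteq> {..<n} \<and> length hs = 2 * n}"
  have "?S \<subseteq> (\<lambda>(ys, hs). map ((!) ys) hs) ` (?Y \<times> ?H)"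
  proof
    fix xs assume xs: "xs \<in> ?S"
    have "2 * card (set xs) = (\<Sum>x\<in>set xs. 2)" by simp
    also have "\<dots> \<le> (\<Sum>x\<in>set xs. count_list xs x)"
    proof (rule sum_mono)
      fix x assume x: "x \<in> set xs"
      hence "count_list xs x \<noteq> 0" by (simp add: count_list_0_iff)
      moreover have "count_list xs x \<noteq> 1" using xs x by blast
      ultimately show "2 \<le> count_list xs x" by linarith
    qed
    also have "\<dots> = length xs" by (rule sum_count_set) auto
    finally have card: "card (set xs) \<le> n" using xs by simp
    obtain us where us: "set us = set xs" "distinct us" using finite_distinct_list[OF finite_set[of xs]] by blast
    have lus: "length us \<le> n" using card us distinct_card[of us] by simp
    \<comment> \<open>Padding brings the list of distinct elements to length \<open>n\<close>.\<close>
    define ys where "ys = us @ replicate (n - length us) (hd xs)"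
    have "set ys \<subseteq> set xs"
    proof (cases "xs = []")
      case True
      hence "n = 0" using xs by simp
      thus ?thesis using us by (simp add: ys_def)
    next
      case False
      hence "hd xs \<in> set xs" by simp
      thus ?thesis unfolding ys_def set_append us(1) by (auto simp: set_replicate_conv_if)
    qed
    hence ys: "ys \<in> ?Y" using xs lus by (auto simp: ys_def)
    have "\<forall>x\<in>set xs. \<exists>i<n. ys ! i = x"
    proof
      fix x assume "x \<in> set xs"
      hence "x \<in> set us" using us by simp
      then obtain i where "i < length us" "us ! i = x" by (auto simp: in_set_conv_nth)
      thus "\<exists>i<n. ys ! i = x" using lus by (intro exI[of _ i]) (auto simp: ys_def nth_append)
    qed
    from bchoice[OF this[unfolded Bex_def]] have "\<exists>h. \<forall>x\<in>set xs. h x < n \<and> ys ! (h x) = x" .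
    then obtain h where h: "\<And>x. x \<in> set xs \<Longrightarrow> h x < n \<and> ys ! (h x) = x" by blast
    have "map h xs \<in> ?H" using h xs by auto
    moreover have "map ((!) ys) (map h xs) = xs" using h by (simp add: map_idI)
    ultimately show "xs \<in> (\<lambda>(ys, hs). map ((!) ys) hs) ` (?Y \<times> ?H)"
      using ys by (intro image_eqI[of _ _ "(ys, map h xs)"]) auto
  qed
  hence "card ?S \<le> card ((\<lambda>(ys, hs). map ((!) ys) hs) ` (?Y \<times> ?H))"
    using assms by (intro card_mono finite_imageI finite_cartesian_product finite_lists_length_eq finite_lessThan)
  also have "\<dots> \<le> card (?Y \<times> ?H)"
    using assms by (intro card_image_le finite_cartesian_product finite_lists_length_eq finite_lessThan)
  also have "\<dots> = card D ^ n * n ^ (2 * n)"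
    using assms by (simp add: card_cartesian_product card_lists_length_eq)
  finally show ?thesis by (simp add: mult.commute)
qed

text \<open>
  The unique element is moved to the front. If it belongs to a conjugated factor, then the whole sum
  is conjugated first.
\<close>
lemma weil_bound_list:
  assumes p: "prime p" and chi: "dirichlet_char p chi" "chi \<noteq> principal_char p"
    and D: "set (ds @ es) \<subseteq> {..<p}" and a: "count_list (ds @ es) a = 1"
  shows "cmod (\<Sum>x\<in>{0..<int p}. (\<Prod>d\<leftarrow>ds. chi (int d - x)) * (\<Prod>e\<leftarrow>es. cnj (chi (int e - x))))
    \<le> real (length ds + length es) * sqrt (real p)"
proof -
  have main: "cmod (\<Sum>x\<in>{0..<int p}. (\<Prod>d\<leftarrow>ds. chi (int d - x)) * (\<Prod>e\<leftarrow>es. cnj (chi (int e - x))))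
    \<le> real (length ds + length es) * sqrt (real p)"
    if D: "set (ds @ es) \<subseteq> {..<p}" and a: "count_list (ds @ es) a = 1" and mem: "a \<in> set ds" for ds es
  proof -
    obtain us vs where uv: "ds = us @ a # vs" using mem by (meson split_list)
    have notin: "a \<notin> set (us @ vs @ es)" using a by (simp add: uv count_list_0_iff)
    have "cmod (\<Sum>x\<in>{0..<int p}. chi (int a - x) * (\<Prod>b\<leftarrow>map int (us @ vs). chi (b - x))
        * (\<Prod>b\<leftarrow>map int es. cnj (chi (b - x))))
      \<le> real (length (map int (us @ vs)) + length (map int es) + 1) * sqrt (real p)"
    proof (rule weil_bound[OF p chi])
      fix b assume "b \<in> set (map int (us @ vs)) \<union> set (map int es)"
      then obtain n where n: "b = int n" "n \<in> set (us @ vs @ es)" by auto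
      have "n < p" "a < p" "n \<noteq> a" using n notin D by (auto simp: uv)
      thus "\<not> [b = int a] (mod int p)"
        by (simp add: n unique_euclidean_semiring_class.cong_def)
    qed
    moreover have "(\<Prod>d\<leftarrow>ds. chi (int d - x)) = chi (int a - x) * (\<Prod>b\<leftarrow>map int (us @ vs). chi (b - x))" for x
      by (simp add: uv o_def)
    moreover have "(\<Prod>e\<leftarrow>es. cnj (chi (int e - x))) = (\<Prod>b\<leftarrow>map int es. cnj (chi (b - x)))" for x
      by (simp add: o_def)
    moreover have "length (map int (us @ vs)) + length (map int es) + 1 = length ds + length es"
      by (simp add: uv)
    ultimately show ?thesis by (simp only:)
  qed
  show ?thesis
  proof (cases "a \<in> set ds")
    case True
    thus ?thesis using main D a by blast
  next
    case False
    have "a \<in> set (ds @ es)" using a count_list_0_iff[of "ds @ es" a] by (metis zero_neq_one)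
    hence "a \<in> set es" using False by simp
    hence *: "cmod (\<Sum>x\<in>{0..<int p}. (\<Prod>d\<leftarrow>es. chi (int d - x)) * (\<Prod>e\<leftarrow>ds. cnj (chi (int e - x))))
      \<le> real (length es + length ds) * sqrt (real p)"
      using main[of es ds] D a by auto
    have cnj_prod: "cnj (\<Prod>d\<leftarrow>xs. f d) = (\<Prod>d\<leftarrow>xs. cnj (f d))" for f :: "nat \<Rightarrow> complex" and xs
      by (induction xs) auto
    have eq: "cnj (\<Sum>x\<in>{0..<int p}. (\<Prod>d\<leftarrow>es. chi (int d - x)) * (\<Prod>e\<leftarrow>ds. cnj (chi (int e - x))))
      = (\<Sum>x\<in>{0..<int p}. (\<Prod>d\<leftarrow>ds. chi (int d - x)) * (\<Prod>e\<leftarrow>es. cnj (chi (int e - x))))"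
      by (simp add: cnj_prod mult.commute)
    show ?thesis using * arg_cong[OF eq, of cmod] by (simp only: complex_mod_cnj add.commute)
  qed
qed

text \<open>
  Expand the power into a sum over pairs of lists \<open>ds\<close> and \<open>es\<close> of length \<open>n\<close>. If some element occurs
  exactly once in \<open>ds @ es\<close>, then Weil's bound gives the saving of \<open>sqrt p\<close>; the other pairs are so few
  that the trivial bound \<open>p\<close> suffices for them.
\<close>
lemma character_moment_bound:
  fixes \<alpha> :: "nat \<Rightarrow> complex"
  assumes p: "prime p" and chi: "dirichlet_char p chi" "chi \<noteq> principal_char p"
    and D: "D \<subseteq> {..<p}" and \<alpha>: "\<And>d. d \<in> D \<Longrightarrow> cmod (\<alpha> d) \<le> 1"
  shows "(\<Sum>x\<in>{0..<int p}. cmod (\<Sum>d\<in>D. \<alpha> d * chi (int d - x)) ^ (2 * n))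
    \<le> real (n ^ (2 * n)) * real p * real (card D) ^ n + real (2 * n) * sqrt (real p) * real (card D) ^ (2 * n)"
proof -
  have finD: "finite D" using finite_subset[OF D] by simp
  let ?L = "\<lambda>n. {xs. set xs \<subseteq> D \<and> length xs = n}"
  let ?P = "{0..<int p}"
  define W where "W = (\<lambda>ds es. \<Sum>x\<in>?P. (\<Prod>d\<leftarrow>ds. chi (int d - x)) * (\<Prod>e\<leftarrow>es. cnj (chi (int e - x))))"
  define w where "w = (\<lambda>ds es. (\<Prod>d\<leftarrow>ds. \<alpha> d) * (\<Prod>e\<leftarrow>es. cnj (\<alpha> e)))"
  define B where "B = {xs. set xs \<subseteq> D \<and> length xs = 2 * n \<and> (\<forall>x\<in>set xs. count_list xs x \<noteq> 1)}"
  have le1: "cmod (chi k) \<le> 1" for k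
    by (rule norm_dirichlet_char_le_1[OF chi(1) prime_gt_0_nat[OF p]])
  have prod_le1: "cmod (\<Prod>d\<leftarrow>xs. f d) \<le> 1" if "\<And>d. d \<in> set xs \<Longrightarrow> cmod (f d) \<le> 1"
    for xs :: "nat list" and f
    using that by (induction xs) (auto simp: norm_mult intro!: mult_le_one)
  have prod_mult: "(\<Prod>d\<leftarrow>xs. f d * g d) = (\<Prod>d\<leftarrow>xs. f d) * (\<Prod>d\<leftarrow>xs. g d)"
    for xs :: "nat list" and f g :: "nat \<Rightarrow> complex" by (induction xs) auto
  have W_trivial: "cmod (W ds es) \<le> real p" for ds es
  proof -
    have "cmod (W ds es) \<le> real (card ?P) * 1"
      unfolding W_def
    proof (rule order_trans[OF norm_sum sum_bounded_above])
      fix x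
      have "cmod (\<Prod>d\<leftarrow>ds. chi (int d - x)) \<le> 1" "cmod (\<Prod>e\<leftarrow>es. cnj (chi (int e - x))) \<le> 1"
        using le1 by (auto intro!: prod_le1)
      thus "cmod ((\<Prod>d\<leftarrow>ds. chi (int d - x)) * (\<Prod>e\<leftarrow>es. cnj (chi (int e - x)))) \<le> 1"
        by (simp add: norm_mult mult_le_one)
    qed
    thus ?thesis by simp
  qed
  have expand: "complex_of_real (cmod (\<Sum>d\<in>D. \<alpha> d * chi (int d - x)) ^ (2 * n))
    = (\<Sum>ds\<in>?L n. \<Sum>es\<in>?L n. w ds es * ((\<Prod>d\<leftarrow>ds. chi (int d - x)) * (\<Prod>e\<leftarrow>es. cnj (chi (int e - x)))))" for x
  proof -
    let ?s = "\<Sum>d\<in>D. \<alpha> d * chi (int d - x)"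
    have "complex_of_real (cmod ?s ^ (2 * n)) = (?s * cnj ?s) ^ n"
      unfolding power_mult of_real_power[of "cmod ?s ^ 2"] complex_norm_square ..
    also have "\<dots> = ?s ^ n * (\<Sum>d\<in>D. cnj (\<alpha> d) * cnj (chi (int d - x))) ^ n"
      by (simp add: power_mult_distrib)
    also have "\<dots> = (\<Sum>ds\<in>?L n. \<Sum>es\<in>?L n. (\<Prod>d\<leftarrow>ds. \<alpha> d * chi (int d - x)) * (\<Prod>e\<leftarrow>es. cnj (\<alpha> e) * cnj (chi (int e - x))))"
      by (simp add: power_sum_eq_sum_lists[OF finD] sum_product)
    also have "\<dots> = (\<Sum>ds\<in>?L n. \<Sum>es\<in>?L n. w ds es * ((\<Prod>d\<leftarrow>ds. chi (int d - x)) * (\<Prod>e\<leftarrow>es. cnj (chi (int e - x)))))"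
      by (simp add: prod_mult w_def mult_ac)
    finally show ?thesis .
  qed
  have "complex_of_real (\<Sum>x\<in>?P. cmod (\<Sum>d\<in>D. \<alpha> d * chi (int d - x)) ^ (2 * n))
    = (\<Sum>x\<in>?P. \<Sum>ds\<in>?L n. \<Sum>es\<in>?L n. w ds es * ((\<Prod>d\<leftarrow>ds. chi (int d - x)) * (\<Prod>e\<leftarrow>es. cnj (chi (int e - x)))))"
    unfolding of_real_sum by (intro sum.cong refl expand)
  also have "\<dots> = (\<Sum>ds\<in>?L n. \<Sum>x\<in>?P. \<Sum>es\<in>?L n. w ds es * ((\<Prod>d\<leftarrow>ds. chi (int d - x)) * (\<Prod>e\<leftarrow>es. cnj (chi (int e - x)))))"
    by (rule sum.swap)
  also have "\<dots> = (\<Sum>ds\<in>?L n. \<Sum>es\<in>?L n. w ds es * W ds es)"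
    unfolding W_def sum_distrib_left by (rule sum.cong[OF refl], rule sum.swap)
  finally have eq: "complex_of_real (\<Sum>x\<in>?P. cmod (\<Sum>d\<in>D. \<alpha> d * chi (int d - x)) ^ (2 * n))
      = (\<Sum>ds\<in>?L n. \<Sum>es\<in>?L n. w ds es * W ds es)" .
  have "(\<Sum>x\<in>?P. cmod (\<Sum>d\<in>D. \<alpha> d * chi (int d - x)) ^ (2 * n))
      \<le> cmod (\<Sum>ds\<in>?L n. \<Sum>es\<in>?L n. w ds es * W ds es)"
    unfolding eq[symmetric] norm_of_real by (rule abs_ge_self)
  also have "\<dots> \<le> (\<Sum>ds\<in>?L n. \<Sum>es\<in>?L n. cmod (w ds es * W ds es))"
    by (rule order_trans[OF norm_sum]) (intro sum_mono norm_sum)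
  also have "\<dots> \<le> (\<Sum>ds\<in>?L n. \<Sum>es\<in>?L n. (if ds @ es \<in> B then real p else 0) + real (2 * n) * sqrt (real p))"
  proof (intro sum_mono)
    fix ds es assume ds: "ds \<in> ?L n" and es: "es \<in> ?L n"
    have "cmod (\<Prod>d\<leftarrow>ds. \<alpha> d) \<le> 1" "cmod (\<Prod>e\<leftarrow>es. cnj (\<alpha> e)) \<le> 1"
      using \<alpha> ds es by (auto intro!: prod_le1)
    hence "cmod (w ds es) \<le> 1" by (simp add: w_def norm_mult mult_le_one)
    hence "cmod (w ds es * W ds es) \<le> cmod (W ds es)"
      by (simp add: norm_mult mult_left_le_one_le)
    also have "\<dots> \<le> (if ds @ es \<in> B then real p else 0) + real (2 * n) * sqrt (real p)"
    proof (cases "ds @ es \<in> B")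
      case True
      have "0 \<le> real (2 * n) * sqrt (real p)" by simp
      from add_mono[OF W_trivial[of ds es] this] show ?thesis using True by simp
    next
      case False
      then obtain a where a: "count_list (ds @ es) a = 1" using ds es by (auto simp: B_def)
      have "cmod (W ds es) \<le> real (length ds + length es) * sqrt (real p)"
        unfolding W_def by (rule weil_bound_list[OF p chi _ a]) (use ds es D in auto)
      thus ?thesis using ds es False by simp
    qed
    finally show "cmod (w ds es * W ds es) \<le> (if ds @ es \<in> B then real p else 0) + real (2 * n) * sqrt (real p)" .
  qed
  also have "\<dots> = (\<Sum>x\<in>?L n \<times> ?L n. (if fst x @ snd x \<in> B then real p else 0)) + (\<Sum>x\<in>?L n \<times> ?L n. real (2 * n) * sqrt (real p))"
    by (simp only: sum.cartesian_product sum.distrib case_prod_unfold)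
  also have "(\<Sum>x\<in>?L n \<times> ?L n. (if fst x @ snd x \<in> B then real p else 0)) \<le> real (n ^ (2 * n)) * real p * real (card D) ^ n"
  proof -
    have fin: "finite (?L n \<times> ?L n)" using finD by (intro finite_cartesian_product finite_lists_length_eq)
    have "card {x\<in>?L n \<times> ?L n. fst x @ snd x \<in> B} \<le> card B"
    proof (rule card_inj_on_le[of "\<lambda>x. fst x @ snd x"])
      show "inj_on (\<lambda>x. fst x @ snd x) {x\<in>?L n \<times> ?L n. fst x @ snd x \<in> B}"
        by (rule inj_onI) (auto simp: prod_eq_iff)
      show "finite B"
        by (rule finite_subset[OF _ finite_lists_length_eq[OF finD, of "2 * n"]]) (auto simp: B_def)
      show "(\<lambda>x. fst x @ snd x) ` {x\<in>?L n \<times> ?L n. fst x @ snd x \<in> B} \<subseteq> B" by blast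
    qed
    also have "\<dots> \<le> n ^ (2 * n) * card D ^ n"
      unfolding B_def by (rule card_lists_without_unique_element[OF finD])
    finally have "real (card {x\<in>?L n \<times> ?L n. fst x @ snd x \<in> B}) \<le> real (n ^ (2 * n) * card D ^ n)"
      by (simp only: of_nat_le_iff)
    hence "real (card {x\<in>?L n \<times> ?L n. fst x @ snd x \<in> B}) * real p \<le> real (n ^ (2 * n) * card D ^ n) * real p"
      by (rule mult_right_mono) simp
    moreover have "(\<Sum>x\<in>?L n \<times> ?L n. (if fst x @ snd x \<in> B then real p else 0))
        = real (card {x\<in>?L n \<times> ?L n. fst x @ snd x \<in> B}) * real p"
      using fin by (simp add: sum.inter_filter[symmetric])
    ultimately show ?thesis by (simp add: mult_ac)
  qed
  also have "(\<Sum>x\<in>?L n \<times> ?L n. real (2 * n) * sqrt (real p)) = real (2 * n) * sqrt (real p) * real (card D) ^ (2 * n)"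
  proof -
    have "real (card D) ^ (2 * n) = real (card D ^ n * card D ^ n)"
      by (simp only: mult.commute[of 2 n] power_mult power2_eq_square of_nat_mult of_nat_power)
    thus ?thesis
      by (simp only: sum_constant card_cartesian_product card_lists_length_eq[OF finD] mult.commute)
  qed
  finally show ?thesis by simp
qed

section \<open>Counting coincidences\<close>

text \<open>
  Jensen's inequality for \<open>\<lambda>x. x ^ Suc n\<close>.
\<close>
lemma power_mean_sum:
  fixes f :: "'i \<Rightarrow> real"
  assumes fin: "finite S" and nonneg: "\<And>i. i \<in> S \<Longrightarrow> f i \<ge> 0"
  shows "(\<Sum>i\<in>S. f i) ^ Suc n \<le> real (card S) ^ n * (\<Sum>i\<in>S. f i ^ Suc n)"
proof (cases "S = {}")
  case False
  define c where "c = real (card S)"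
  have c: "c > 0" using False fin by (simp add: c_def card_gt_0_iff)
  have "convex_on {0::real..} (\<lambda>x. x ^ Suc n)"
  proof (cases "even (Suc n)")
    case True
    show ?thesis using convex_on_subset[OF convex_power_even[OF True]] by simp
  next
    case False
    thus ?thesis by (rule convex_power_odd)
  qed
  from convex_on_sum[OF fin False this, of "\<lambda>_. 1 / c" f]
  have "(\<Sum>i\<in>S. (1 / c) *\<^sub>R f i) ^ Suc n \<le> (\<Sum>i\<in>S. (1 / c) * f i ^ Suc n)"
    using c nonneg by (simp add: c_def)
  hence le: "((\<Sum>i\<in>S. f i) / c) ^ Suc n \<le> (\<Sum>i\<in>S. f i ^ Suc n) / c"
    by (simp add: sum_divide_distrib)
  have "(\<Sum>i\<in>S. f i) ^ Suc n = c ^ Suc n * ((\<Sum>i\<in>S. f i) / c) ^ Suc n"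
    using c by (simp add: power_divide del: power_Suc)
  also have "\<dots> \<le> c ^ Suc n * ((\<Sum>i\<in>S. f i ^ Suc n) / c)"
    using le c by (intro mult_left_mono) auto
  also have "\<dots> = c ^ n * (\<Sum>i\<in>S. f i ^ Suc n)" using c by simp
  finally show ?thesis by (simp add: c_def)
qed auto

text \<open>
  Hoelder's inequality for the fibre sizes of \<open>X\<close>, with all exponents cleared: apply Jensen's inequality,
  collect the \<open>\<omega>\<close> with the same \<open>X \<omega>\<close>, and apply the Cauchy-Schwarz inequality.
\<close>
lemma sum_over_map_power_le:
  fixes M :: "'x \<Rightarrow> real"
  assumes fin: "finite \<Omega>" "finite P" and X: "\<And>\<omega>. \<omega> \<in> \<Omega> \<Longrightarrow> X \<omega> \<in> P" and M: "\<And>x. M x \<ge> 0"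
  shows "(\<Sum>\<omega>\<in>\<Omega>. M (X \<omega>)) ^ (2 * Suc n)
    \<le> real (card \<Omega>) ^ (2 * n) * real (card {(\<omega>, \<omega>') \<in> \<Omega> \<times> \<Omega>. X \<omega> = X \<omega>'}) * (\<Sum>x\<in>P. M x ^ (2 * Suc n))"
proof -
  define F where "F = (\<lambda>x. {\<omega>\<in>\<Omega>. X \<omega> = x})"
  have finF: "finite (F x)" for x using fin by (simp add: F_def)
  have "{(\<omega>, \<omega>') \<in> \<Omega> \<times> \<Omega>. X \<omega> = X \<omega>'} = (\<Union>x\<in>P. F x \<times> F x)" using X by (auto simp: F_def)
  also have "card \<dots> = (\<Sum>x\<in>P. card (F x \<times> F x))"
    by (rule card_UN_disjoint) (use fin finF in \<open>auto simp: F_def\<close>)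
  finally have E: "real (card {(\<omega>, \<omega>') \<in> \<Omega> \<times> \<Omega>. X \<omega> = X \<omega>'}) = (\<Sum>x\<in>P. real (card (F x)) ^ 2)"
    by (simp add: card_cartesian_product power2_eq_square)
  have "(\<Sum>\<omega>\<in>\<Omega>. M (X \<omega>)) ^ (2 * Suc n) = ((\<Sum>\<omega>\<in>\<Omega>. M (X \<omega>)) ^ Suc n) ^ 2"
    by (simp only: power_mult mult.commute)
  also have "\<dots> \<le> (real (card \<Omega>) ^ n * (\<Sum>\<omega>\<in>\<Omega>. M (X \<omega>) ^ Suc n)) ^ 2"
    by (intro power_mono power_mean_sum fin M zero_le_power sum_nonneg)
  also have "(\<Sum>\<omega>\<in>\<Omega>. M (X \<omega>) ^ Suc n) = (\<Sum>x\<in>P. \<Sum>\<omega>\<in>F x. M (X \<omega>) ^ Suc n)"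
    unfolding F_def by (rule sum.group[symmetric]) (use fin X in auto)
  also have "\<dots> = (\<Sum>x\<in>P. real (card (F x)) * M x ^ Suc n)"
    by (rule sum.cong[OF refl]) (simp add: F_def)
  also have "(real (card \<Omega>) ^ n * \<dots>) ^ 2 = real (card \<Omega>) ^ (2 * n) * (\<Sum>x\<in>P. real (card (F x)) * M x ^ Suc n) ^ 2"
    by (simp only: power_mult_distrib power_mult[symmetric] mult.commute)
  also have "(\<Sum>x\<in>P. real (card (F x)) * M x ^ Suc n) ^ 2
      \<le> (\<Sum>x\<in>P. real (card (F x)) ^ 2) * (\<Sum>x\<in>P. (M x ^ Suc n) ^ 2)"
    by (rule Cauchy_Schwarz_ineq_sum)
  also have "(\<Sum>x\<in>P. (M x ^ Suc n) ^ 2) = (\<Sum>x\<in>P. M x ^ (2 * Suc n))"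
    by (simp only: power_mult[symmetric] mult.commute)
  finally show ?thesis by (simp only: E mult.assoc mult_left_mono zero_le_power of_nat_0_le_iff)
qed

lemma dvd_triple_product_split:
  fixes a x y z :: nat
  assumes "a dvd x * y * z"
  obtains u v w x' y' z' where "a = u * v * w" "x = u * x'" "y = v * y'" "z = w * z'"
proof -
  obtain s w where s: "a = s * w" "s dvd x * y" "w dvd z" using division_decomp[OF assms] by blast
  obtain u v where u: "s = u * v" "u dvd x" "v dvd y" using division_decomp[OF s(2)] by blast
  show ?thesis using s u that by (elim dvdE) metis
qed

text \<open>
  Two factorisations of the same number have a common refinement, a matrix with row products
  \<open>x1, x2, x3\<close> and column products \<open>y1, y2, y3\<close>. The rows are found one at a time.
\<close>
lemma equal_triple_products_refine:
  fixes x1 x2 x3 y1 y2 y3 :: nat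
  assumes eq: "x1 * x2 * x3 = y1 * y2 * y3" and pos: "x1 * x2 * x3 > 0"
  obtains a1 a2 a3 b1 b2 b3 c1 c2 c3 where
    "x1 = a1 * a2 * a3" "x2 = b1 * b2 * b3" "x3 = c1 * c2 * c3"
    "y1 = a1 * b1 * c1" "y2 = a2 * b2 * c2" "y3 = a3 * b3 * c3"
proof -
  have "x1 dvd y1 * y2 * y3" unfolding eq[symmetric] by simp
  then obtain a1 a2 a3 y1' y2' y3' where a: "x1 = a1 * a2 * a3" "y1 = a1 * y1'" "y2 = a2 * y2'" "y3 = a3 * y3'"
    by (rule dvd_triple_product_split)
  have "x1 * (x2 * x3) = x1 * (y1' * y2' * y3')" using eq by (simp add: a mult_ac)
  hence eq': "x2 * x3 = y1' * y2' * y3'" using pos by simp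
  hence "x2 dvd y1' * y2' * y3'" by (metis dvd_triv_left)
  then obtain b1 b2 b3 c1 c2 c3 where b: "x2 = b1 * b2 * b3" "y1' = b1 * c1" "y2' = b2 * c2" "y3' = b3 * c3"
    by (rule dvd_triple_product_split)
  have "x2 * x3 = x2 * (c1 * c2 * c3)" using eq' by (simp add: b mult_ac)
  hence "x3 = c1 * c2 * c3" using pos by simp
  thus ?thesis using that a b by (simp add: mult.assoc)
qed

definition triples_below :: "nat \<Rightarrow> (nat \<times> nat \<times> nat) set" where
  "triples_below N = {(u, v, w). u * v * w \<in> {1..N}}"

text \<open>
  Given \<open>u\<close> and \<open>v\<close>, there are at most \<open>N / (u * v)\<close> choices for \<open>w\<close>.
\<close>
lemma card_triples_below:
  shows "finite (triples_below N)"
    and "real (card (triples_below N)) \<le> real N * harm N ^ 2"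
proof -
  let ?S = "Sigma ({1..N} \<times> {1..N}) (\<lambda>(u, v). {1..N div (u * v)})"
  have finS: "finite ?S" by (rule finite_SigmaI) auto
  have sub: "triples_below N \<subseteq> (\<lambda>((u, v), w). (u, v, w)) ` ?S"
  proof
    fix t assume "t \<in> triples_below N"
    then obtain u v w where t: "t = (u, v, w)" "1 \<le> u * v * w" "u * v * w \<le> N"
      by (auto simp: triples_below_def)
    have pos: "u \<ge> 1" "v \<ge> 1" "w \<ge> 1" using t(2) by (auto simp: Suc_le_eq)
    have "u * v \<le> u * v * w" using pos by simp
    moreover have "u \<le> u * v" "v \<le> u * v" using pos by simp_all
    ultimately have "u \<le> N" "v \<le> N" using t(3) by linarith+
    moreover have "w \<le> N div (u * v)" using t(3) pos by (simp add: less_eq_div_iff_mult_less_eq mult.commute)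
    ultimately have "((u, v), w) \<in> ?S" using pos by simp
    thus "t \<in> (\<lambda>((u, v), w). (u, v, w)) ` ?S" using t(1) by force
  qed
  show fin: "finite (triples_below N)" by (rule finite_subset[OF sub finite_imageI[OF finS]])
  have "card (triples_below N) \<le> card ?S"
    by (rule order_trans[OF card_mono[OF finite_imageI[OF finS] sub] card_image_le[OF finS]])
  also have "\<dots> = (\<Sum>(u, v)\<in>{1..N} \<times> {1..N}. N div (u * v))"
    by (subst card_SigmaI) (auto simp: case_prod_unfold)
  finally have "real (card (triples_below N)) \<le> (\<Sum>(u, v)\<in>{1..N} \<times> {1..N}. real (N div (u * v)))"
    by (metis (mono_tags, lifting) case_prod_unfold of_nat_le_iff of_nat_sum sum.cong)
  also have "\<dots> \<le> (\<Sum>(u, v)\<in>{1..N} \<times> {1..N}. real N * (1 / real u * (1 / real v)))"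
  proof (rule sum_mono, clarify)
    fix u v
    have "real (N div (u * v)) \<le> real N / real (u * v)" by (metis floor_divide_of_nat_eq of_int_floor_le of_int_of_nat_eq)
    thus "real (N div (u * v)) \<le> real N * (1 / real u * (1 / real v))" by simp
  qed
  also have "\<dots> = real N * ((\<Sum>u=1..N. 1 / real u) * (\<Sum>v=1..N. 1 / real v))"
    by (subst sum.cartesian_product [symmetric], subst sum_product) (simp only: sum_distrib_left)
  also have "(\<Sum>u=1..N. 1 / real u) = harm N" by (simp add: harm_def inverse_eq_divide)
  finally show "real (card (triples_below N)) \<le> real N * harm N ^ 2" by (simp add: power2_eq_square)
qed

text \<open>
  The equation \<open>a * b * c' = a' * b' * c\<close> is refined to a \<open>3 \<times> 3\<close> matrix. Its rows have the products \<open>a\<close>, \<open>b\<close>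
  and \<open>c'\<close>, and the size conditions on these three numbers alone bound the number of matrices.
\<close>
lemma card_multiplicative_energy_le:
  fixes A B C :: nat
  defines "\<Omega> \<equiv> {1..A} \<times> {1..B} \<times> {1..C}"
  shows "card {(\<omega>, \<omega>') \<in> \<Omega> \<times> \<Omega>. (case \<omega> of (a, b, c) \<Rightarrow> case \<omega>' of (a', b', c') \<Rightarrow> a * b * c' = a' * b' * c)}
    \<le> card (triples_below A) * card (triples_below B) * card (triples_below C)" (is "card ?E \<le> _")
proof -
  let ?G = "triples_below A \<times> triples_below B \<times> triples_below C"
  define h where "h = (\<lambda>((a1, a2, a3), (b1, b2, b3), (c1, c2, c3)).
     ((a1 * a2 * a3, b1 * b2 * b3, a3 * b3 * c3), (a1 * b1 * c1, a2 * b2 * c2, c1 * c2 * c3)) ::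
       (nat \<times> nat \<times> nat) \<times> (nat \<times> nat \<times> nat))"
  have finG: "finite ?G" using card_triples_below(1) by blast
  have "?E \<subseteq> h ` ?G"
  proof
    fix t assume "t \<in> ?E"
    then obtain a b c a' b' c' where t: "t = ((a, b, c), (a', b', c'))"
      and mem: "a \<in> {1..A}" "b \<in> {1..B}" "c' \<in> {1..C}" and eq: "a * b * c' = a' * b' * c"
      by (auto simp: \<Omega>_def)
    have "a * b * c' > 0" using mem by simp
    with eq obtain a1 a2 a3 b1 b2 b3 c1 c2 c3 where
      r: "a = a1 * a2 * a3" "b = b1 * b2 * b3" "c' = c1 * c2 * c3"
        "a' = a1 * b1 * c1" "b' = a2 * b2 * c2" "c = a3 * b3 * c3"
      by (rule equal_triple_products_refine)
    have "((a1, a2, a3), (b1, b2, b3), (c1, c2, c3)) \<in> ?G"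
      using mem by (simp add: triples_below_def r)
    moreover have "t = h ((a1, a2, a3), (b1, b2, b3), (c1, c2, c3))" by (simp add: h_def t r)
    ultimately show "t \<in> h ` ?G" by blast
  qed
  hence "card ?E \<le> card ?G" using finG by (meson card_image_le card_mono finite_imageI order_trans)
  thus ?thesis by (simp add: card_cartesian_product)
qed

lemma harm_le_2_ln:
  assumes "N < p" "p \<ge> 3"
  shows "harm N \<le> 2 * ln (real p)"
proof (cases "N = 0")
  case False
  have "harm N - ln (real N) \<le> harm 1 - ln (real 1)"
    using False by (intro euler_mascheroni_sequence_decreasing) auto
  hence "harm N \<le> 1 + ln (real N)" by (simp add: harm_def)
  also have "ln (real N) \<le> ln (real p)" using assms False by simp
  also have "1 \<le> ln (real p)"
  proof -
    have "exp 1 \<le> real p" using exp_le assms(2) by linarith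
    thus ?thesis using assms(2) by (subst ln_ge_iff) auto
  qed
  finally show ?thesis by simp
qed (use assms in \<open>simp add: harm_def\<close>)

section \<open>The bound for the trilinear sums\<close>

text \<open>
  Modulo \<open>2\<close> only the principal character exists. The conclusion serves to have \<open>1 \<le> ln p\<close>.
\<close>
lemma nonprincipal_imp_prime_ge_3:
  assumes p: "prime p" and chi: "dirichlet_char p chi" "chi \<noteq> principal_char p"
  shows "p \<ge> 3"
proof (rule ccontr)
  assume "\<not> p \<ge> 3"
  hence p2: "p = 2" using prime_ge_2_nat[OF p] by simp
  have c1: "chi 1 = 1"
  proof -
    have "chi 1 * chi 1 = chi 1" using dirichlet_charD(1)[OF chi(1), of 1 1] by simp
    moreover have "chi 1 \<noteq> 0" using dirichlet_charD(3)[OF chi(1), of 1] by simp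
    ultimately show ?thesis by simp
  qed
  have "chi k = principal_char p k" for k
  proof (cases "algebraic_semidom_class.coprime k (int p)")
    case True
    hence "odd k" by (simp add: p2)
    hence "[k = 1] (mod int p)"
      unfolding unique_euclidean_semiring_class.cong_def by (simp add: p2 odd_iff_mod_2_eq_one)
    hence "chi k = chi 1" by (rule dirichlet_charD(2)[OF chi(1)])
    thus ?thesis using True c1 by (simp add: principal_char_def)
  next
    case False
    thus ?thesis using dirichlet_charD(3)[OF chi(1), of k] by (simp add: principal_char_def)
  qed
  thus False using chi(2) by blast
qed

text \<open>
  Let \<open>X (a, b, c)\<close> be the residue of \<open>a * b / c\<close> modulo \<open>p\<close>. Up to a factor of modulus at most one,
  \<open>chi (a * b - c * d)\<close> is \<open>chi (d - X (a, b, c))\<close>, so the inner sum depends on \<open>X (a, b, c)\<close> only. In the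
  count of pairs with the same residue, \<open>A * B * C < p\<close> turns the congruence
  \<open>a * b * c' = a' * b' * c\<close> modulo \<open>p\<close> into an equation between integers.
\<close>
lemma T_sum_power_bound:
  assumes p: "prime p" and chi: "dirichlet_char p chi" "chi \<noteq> principal_char p"
    and ABC: "A * B * C < p" and pos: "A > 0" "B > 0" "C > 0"
    and D: "D \<subseteq> {..<p}" and \<alpha>: "\<And>d. d \<in> D \<Longrightarrow> cmod (\<alpha> d) \<le> 1"
  shows "T_sum chi A B C D \<alpha> ^ (2 * Suc n) \<le> real (A * B * C) ^ (2 * n)
    * (real (A * B * C) * (2 * ln (real p)) ^ 6)
    * (real (Suc n ^ (2 * Suc n)) * real p * real (card D) ^ Suc n
        + real (2 * Suc n) * sqrt (real p) * real (card D) ^ (2 * Suc n))"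
proof -
  define \<Omega> where "\<Omega> = {1..A} \<times> {1..B} \<times> {1..C}"
  define good where "good = (\<lambda>\<omega> x. case \<omega> of (a, b, c) \<Rightarrow>
    x \<in> {0..<int p} \<and> [int c * x = int a * int b] (mod int p))"
  define X where "X = (\<lambda>\<omega>. SOME x. good \<omega> x)"
  define M where "M = (\<lambda>x. cmod (\<Sum>d\<in>D. \<alpha> d * chi (int d - x)))"
  have p0: "p > 0" using prime_gt_0_nat[OF p] .
  have p3: "p \<ge> 3" by (rule nonprincipal_imp_prime_ge_3[OF p chi])
  have lt_p: "A < p" "B < p" "C < p"
  proof -
    have "A * 1 \<le> A * (B * C)" "B * 1 \<le> B * (A * C)" "C * 1 \<le> C * (A * B)"
      using pos by (intro mult_le_mono2; simp add: Suc_le_eq)+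
    moreover have "A * (B * C) < p" "B * (A * C) < p" "C * (A * B) < p"
      using ABC by (simp_all add: mult_ac)
    ultimately show "A < p" "B < p" "C < p" by linarith+
  qed
  have good_X: "good \<omega> (X \<omega>)" if \<omega>: "\<omega> \<in> \<Omega>" for \<omega>
    unfolding X_def
  proof (rule someI_ex)
    obtain a b c where abc: "\<omega> = (a, b, c)" "1 \<le> c" "c \<le> C" using \<omega> by (auto simp: \<Omega>_def)
    have "c > 0" "c < p" using abc lt_p(3) by linarith+
    hence "\<not> p dvd c" by (rule nat_dvd_not_less)
    hence "algebraic_semidom_class.coprime p c" by (rule prime_imp_coprime[OF p])
    hence "algebraic_semidom_class.coprime (int c) (int p)"
      by (simp add: algebraic_semidom_class.coprime_commute)
    then obtain y where y: "[int c * y = 1] (mod int p)" using cong_solve_coprime_int by blast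
    have "[int c * (y * (int a * int b)) = 1 * (int a * int b)] (mod int p)"
      unfolding mult.assoc[symmetric, of "int c" y] by (intro cong_mult y cong_refl)
    hence "[int c * (y * (int a * int b) mod int p) = int a * int b] (mod int p)"
      by (simp add: unique_euclidean_semiring_class.cong_def mod_mult_right_eq)
    thus "\<exists>x. good \<omega> x" using p0 abc(1)
      by (intro exI[of _ "y * (int a * int b) mod int p"]) (simp add: good_def)
  qed
  have term_le: "cmod (\<Sum>d\<in>D. \<alpha> d * chi (int a * int b - int c * int d)) \<le> M (X (a, b, c))"
    if \<omega>: "(a, b, c) \<in> \<Omega>" for a b c
  proof -
    have X: "[int c * X (a, b, c) = int a * int b] (mod int p)" using good_X[OF \<omega>] by (simp add: good_def)
    have "chi (int a * int b - int c * int d) = chi (- int c) * chi (int d - X (a, b, c))" for d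
    proof -
      have "[int a * int b - int c * int d = int c * X (a, b, c) - int c * int d] (mod int p)"
        by (intro cong_diff cong_sym[OF X] cong_refl)
      hence "chi (int a * int b - int c * int d) = chi (int c * X (a, b, c) - int c * int d)"
        by (rule dirichlet_charD(2)[OF chi(1)])
      also have "int c * X (a, b, c) - int c * int d = - int c * (int d - X (a, b, c))"
        by (simp add: algebra_simps)
      finally show ?thesis by (simp only: dirichlet_charD(1)[OF chi(1)])
    qed
    hence "(\<Sum>d\<in>D. \<alpha> d * chi (int a * int b - int c * int d))
        = chi (- int c) * (\<Sum>d\<in>D. \<alpha> d * chi (int d - X (a, b, c)))"
      by (simp add: sum_distrib_left mult_ac)
    thus ?thesis
      using norm_dirichlet_char_le_1[OF chi(1) p0, of "- int c"]
      by (simp add: norm_mult M_def mult_left_le_one_le)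
  qed
  have "T_sum chi A B C D \<alpha>
      = (\<Sum>(a, b, c)\<in>\<Omega>. cmod (\<Sum>d\<in>D. \<alpha> d * chi (int a * int b - int c * int d)))"
    by (simp only: T_sum_def \<Omega>_def sum.cartesian_product)
  also have "\<dots> \<le> (\<Sum>\<omega>\<in>\<Omega>. M (X \<omega>))"
    by (intro sum_mono) (use term_le in auto)
  finally have "T_sum chi A B C D \<alpha> \<le> (\<Sum>\<omega>\<in>\<Omega>. M (X \<omega>))" .
  moreover have "T_sum chi A B C D \<alpha> \<ge> 0" by (auto simp: T_sum_def intro!: sum_nonneg)
  ultimately have "T_sum chi A B C D \<alpha> ^ (2 * Suc n) \<le> (\<Sum>\<omega>\<in>\<Omega>. M (X \<omega>)) ^ (2 * Suc n)"
    by (rule power_mono)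
  also have "\<dots> \<le> real (card \<Omega>) ^ (2 * n) * real (card {(\<omega>, \<omega>') \<in> \<Omega> \<times> \<Omega>. X \<omega> = X \<omega>'})
      * (\<Sum>x\<in>{0..<int p}. M x ^ (2 * Suc n))"
  proof (rule sum_over_map_power_le)
    fix \<omega> assume "\<omega> \<in> \<Omega>"
    thus "X \<omega> \<in> {0..<int p}" using good_X[of \<omega>] by (auto simp: good_def split: prod.splits)
  qed (auto simp: \<Omega>_def M_def)
  also have "\<dots> \<le> real (A * B * C) ^ (2 * n) * (real (A * B * C) * (2 * ln (real p)) ^ 6)
      * (real (Suc n ^ (2 * Suc n)) * real p * real (card D) ^ Suc n
        + real (2 * Suc n) * sqrt (real p) * real (card D) ^ (2 * Suc n))"
  proof (intro mult_mono)
    show "real (card \<Omega>) ^ (2 * n) \<le> real (A * B * C) ^ (2 * n)"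
      by (simp add: \<Omega>_def card_cartesian_product mult.assoc)
    show "(\<Sum>x\<in>{0..<int p}. M x ^ (2 * Suc n)) \<le> real (Suc n ^ (2 * Suc n)) * real p * real (card D) ^ Suc n
        + real (2 * Suc n) * sqrt (real p) * real (card D) ^ (2 * Suc n)"
      unfolding M_def by (rule character_moment_bound[OF p chi D \<alpha>])
    have "{(\<omega>, \<omega>') \<in> \<Omega> \<times> \<Omega>. X \<omega> = X \<omega>'} \<subseteq> {(\<omega>, \<omega>') \<in> \<Omega> \<times> \<Omega>.
        (case \<omega> of (a, b, c) \<Rightarrow> case \<omega>' of (a', b', c') \<Rightarrow> a * b * c' = a' * b' * c)}"
    proof
      fix t assume t_mem: "t \<in> {(\<omega>, \<omega>') \<in> \<Omega> \<times> \<Omega>. X \<omega> = X \<omega>'}"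
      obtain a b c a' b' c' where t: "t = ((a, b, c), (a', b', c'))" by (cases t) auto
      have \<omega>: "(a, b, c) \<in> \<Omega>" "(a', b', c') \<in> \<Omega>" and eq: "X (a, b, c) = X (a', b', c')"
        using t_mem t by auto
      have 1: "[int c * X (a, b, c) = int a * int b] (mod int p)"
        and 2: "[int c' * X (a, b, c) = int a' * int b'] (mod int p)"
        using good_X[OF \<omega>(1)] good_X[OF \<omega>(2)] eq by (simp_all add: good_def)
      have "[int a * int b * int c' = int c * X (a, b, c) * int c'] (mod int p)"
        by (intro cong_mult cong_sym[OF 1] cong_refl)
      also have "int c * X (a, b, c) * int c' = int c' * X (a, b, c) * int c" by simp
      also have "[\<dots> = int a' * int b' * int c] (mod int p)"
        by (intro cong_mult 2 cong_refl)
      finally have "[int (a * b * c') = int (a' * b' * c)] (mod int p)" by simp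
      hence "[a * b * c' = a' * b' * c] (mod p)" by (simp only: cong_int_iff)
      moreover have "a * b * c' < p" "a' * b' * c < p"
        using \<omega> by (auto simp: \<Omega>_def intro!: le_less_trans[OF _ ABC] mult_le_mono)
      ultimately have "a * b * c' = a' * b' * c" by (simp add: unique_euclidean_semiring_class.cong_def)
      thus "t \<in> {(\<omega>, \<omega>') \<in> \<Omega> \<times> \<Omega>.
          (case \<omega> of (a, b, c) \<Rightarrow> case \<omega>' of (a', b', c') \<Rightarrow> a * b * c' = a' * b' * c)}"
        using \<omega> by (simp add: t)
    qed
    hence "card {(\<omega>, \<omega>') \<in> \<Omega> \<times> \<Omega>. X \<omega> = X \<omega>'} \<le> card {(\<omega>, \<omega>') \<in> \<Omega> \<times> \<Omega>.
        (case \<omega> of (a, b, c) \<Rightarrow> case \<omega>' of (a', b', c') \<Rightarrow> a * b * c' = a' * b' * c)}"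
      by (rule card_mono[rotated]) (rule finite_subset[of _ "\<Omega> \<times> \<Omega>"], auto simp: \<Omega>_def)
    also have "\<dots> \<le> card (triples_below A) * card (triples_below B) * card (triples_below C)"
      unfolding \<Omega>_def by (rule card_multiplicative_energy_le)
    finally have "real (card {(\<omega>, \<omega>') \<in> \<Omega> \<times> \<Omega>. X \<omega> = X \<omega>'})
        \<le> real (card (triples_below A) * card (triples_below B) * card (triples_below C))"
      by (simp only: of_nat_le_iff)
    also have "\<dots> = real (card (triples_below A)) * real (card (triples_below B)) * real (card (triples_below C))"
      by (simp only: of_nat_mult)
    also have "\<dots> \<le> (real A * (2 * ln (real p)) ^ 2) * (real B * (2 * ln (real p)) ^ 2) * (real C * (2 * ln (real p)) ^ 2)"
    proof -
      have "real (card (triples_below N)) \<le> real N * (2 * ln (real p)) ^ 2" if "N < p" for N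
      proof -
        have "real (card (triples_below N)) \<le> real N * harm N ^ 2" by (rule card_triples_below)
        also have "\<dots> \<le> real N * (2 * ln (real p)) ^ 2"
          using harm_le_2_ln[OF that p3] by (intro mult_left_mono power_mono) (auto simp: harm_nonneg)
        finally show ?thesis .
      qed
      thus ?thesis using lt_p by (intro mult_mono) auto
    qed
    also have "\<dots> = real (A * B * C) * (2 * ln (real p)) ^ 6"
    proof -
      have "(2 * ln (real p)) ^ 6 = (2 * ln (real p)) ^ 2 * (2 * ln (real p)) ^ 2 * (2 * ln (real p)) ^ 2"
        by (simp flip: power_add)
      thus ?thesis by (simp only: of_nat_mult mult_ac)
    qed
    finally show "real (card {(\<omega>, \<omega>') \<in> \<Omega> \<times> \<Omega>. X \<omega> = X \<omega>'})
        \<le> real (A * B * C) * (2 * ln (real p)) ^ 6" .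
    show "0 \<le> (\<Sum>x\<in>{0..<int p}. M x ^ (2 * Suc n))"
      by (intro sum_nonneg zero_le_power) (simp add: M_def)
  qed auto
  finally show ?thesis .
qed

lemma power_add_superadditive:
  fixes u v :: real
  assumes "u \<ge> 0" "v \<ge> 0"
  shows "u ^ Suc n + v ^ Suc n \<le> (u + v) ^ Suc n"
proof (induction n)
  case (Suc n)
  have "u ^ Suc (Suc n) + v ^ Suc (Suc n) \<le> (u + v) * (u ^ Suc n + v ^ Suc n)"
    using assms by (simp add: algebra_simps)
  also have "\<dots> \<le> (u + v) * (u + v) ^ Suc n" using Suc.IH assms by (intro mult_left_mono) auto
  finally show ?case by simp
qed simp

text \<open>
  The two sides are compared after raising them to the power \<open>2 * Suc n\<close>, where the sum of the two
  terms may be split with \<open>u ^ N + v ^ N \<le> (u + v) ^ N\<close>.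
\<close>
lemma le_of_power_bound:
  fixes T X D p L K c1 c2 :: real and n :: nat
  assumes pos: "X \<ge> 1" "D \<ge> 1" "p \<ge> 1" "L \<ge> 1" "c1 \<ge> 1" "c2 \<ge> 0"
    and K: "K = 64 * (c1 + c2)"
    and T: "T ^ (2 * Suc n) \<le> X ^ (2 * n) * (X * (2 * L) ^ 6)
      * (c1 * p * D ^ Suc n + c2 * sqrt p * D ^ (2 * Suc n))"
  shows "T \<le> K * (X * D) * ((p / X) powr (1 / (2 * real (Suc n))) * D powr (- 1 / 2)
      + (p powr (1 / 2) / X) powr (1 / (2 * real (Suc n)))) * L powr (4 / real (Suc n))"
proof -
  define N where "N = 2 * Suc n"
  define s where "s = 1 / (2 * real (Suc n))"
  define u where "u = (p / X) powr s * D powr (- 1 / 2)"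
  define v where "v = (p powr (1 / 2) / X) powr s"
  have sN: "s * real N = 1" by (simp add: s_def N_def)
  have powr_s: "(y powr s) ^ N = y" if "y > 0" for y
    using that by (simp add: powr_power sN mult.commute)
  have uN: "u ^ N = p / X / D ^ Suc n"
  proof -
    have "(D powr (- 1 / 2)) ^ N = D powr (- real (Suc n))"
    proof -
      have "real N * (- 1 / 2) = - real (Suc n)" by (simp add: N_def)
      thus ?thesis using powr_power[of D "- 1 / 2" N] pos by (simp only: mult.commute)
    qed
    also have "\<dots> = 1 / D ^ Suc n" using pos by (simp add: powr_minus powr_realpow divide_inverse del: of_nat_Suc power_Suc)
    finally show ?thesis using pos powr_s[of "p / X"] by (simp add: u_def power_mult_distrib)
  qed
  have vN: "v ^ N = sqrt p / X"
    using pos powr_s[of "p powr (1 / 2) / X"] by (simp add: v_def powr_half_sqrt)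
  have LN: "(L powr (4 / real (Suc n))) ^ N = L ^ 8"
  proof -
    have "(L powr (4 / real (Suc n))) ^ N = L powr (real 8)"
    proof -
      have "real N * (4 / real (Suc n)) = real 8" by (simp add: N_def field_simps)
      thus ?thesis using powr_power[of L "4 / real (Suc n)" N] pos by (simp only: mult.commute)
    qed
    also have "\<dots> = L ^ 8" using pos by (intro powr_realpow) simp
    finally show ?thesis .
  qed
  have K1: "K \<ge> 1" using pos K by simp
  have "T ^ N \<le> X ^ (2 * n) * (X * (2 * L) ^ 6) * (c1 * p * D ^ Suc n + c2 * sqrt p * D ^ N)"
    using T by (simp only: N_def)
  also have "\<dots> \<le> X ^ (2 * n) * (X * (64 * L ^ 8)) * ((c1 + c2) * (p * D ^ Suc n + sqrt p * D ^ N))"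
  proof (intro mult_mono mult_left_mono)
    have "L ^ 6 \<le> L ^ 8" using pos by (intro power_increasing) auto
    thus "(2 * L) ^ 6 \<le> 64 * L ^ 8" by (simp add: power_mult_distrib)
    have "c1 * (p * D ^ Suc n) \<le> (c1 + c2) * (p * D ^ Suc n)"
      "c2 * (sqrt p * D ^ N) \<le> (c1 + c2) * (sqrt p * D ^ N)"
      using pos by (intro mult_right_mono; simp)+
    thus "c1 * p * D ^ Suc n + c2 * sqrt p * D ^ N \<le> (c1 + c2) * (p * D ^ Suc n + sqrt p * D ^ N)"
      by (simp add: distrib_left mult.assoc)
  qed (use pos in auto)
  also have "\<dots> = K * ((X * D) ^ N * (u ^ N + v ^ N) * L ^ 8)"
  proof -
    have XN: "X ^ N = X ^ (2 * n) * X * X" by (simp add: N_def)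
    have DN: "D ^ N = D ^ Suc n * D ^ Suc n" by (simp only: N_def mult_2 power_add)
    have "(X * D) ^ N * (u ^ N + v ^ N) = X ^ (2 * n) * X * (p * D ^ Suc n + sqrt p * D ^ N)"
      unfolding uN vN power_mult_distrib XN DN using pos by (simp add: field_simps)
    thus ?thesis by (simp only: K) (simp only: mult_ac)
  qed
  also have "\<dots> \<le> K * ((X * D) ^ N * (u + v) ^ N * L ^ 8)"
  proof -
    have "u ^ N + v ^ N \<le> (u + v) ^ N"
      using power_add_superadditive[of u v "2 * n + 1"] by (simp add: N_def u_def v_def)
    thus ?thesis using pos K1 by (intro mult_left_mono mult_right_mono) auto
  qed
  also have "\<dots> = K * (X * D * (u + v) * L powr (4 / real (Suc n))) ^ N"
    by (simp only: power_mult_distrib LN)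
  also have "\<dots> \<le> K ^ N * (X * D * (u + v) * L powr (4 / real (Suc n))) ^ N"
    using pos K1 self_le_power[of K N] by (intro mult_right_mono zero_le_power) (auto simp: N_def u_def v_def)
  also have "\<dots> = (K * (X * D) * (u + v) * L powr (4 / real (Suc n))) ^ N"
    by (simp only: power_mult_distrib mult_ac)
  finally have "T ^ N \<le> (K * (X * D) * (u + v) * L powr (4 / real (Suc n))) ^ N" .
  hence "T ^ Suc (2 * n + 1) \<le> (K * (X * D) * (u + v) * L powr (4 / real (Suc n))) ^ Suc (2 * n + 1)"
    by (simp only: N_def) simp
  hence "T \<le> K * (X * D) * (u + v) * L powr (4 / real (Suc n))"
    by (rule power_le_imp_le_base) (use pos K1 in \<open>auto simp: u_def v_def\<close>)
  thus ?thesis by (simp only: u_def v_def s_def)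
qed

theorem theorem1p5:
  fixes \<nu> :: nat
  assumes "\<nu> \<ge> 1"
  shows "\<exists>K :: real. \<forall>(p :: nat) (chi :: int \<Rightarrow> complex) (A :: nat) (B :: nat) (C :: nat) (D :: nat)
             (\<D> :: nat set) (\<alpha> :: nat \<Rightarrow> complex).
           prime p \<longrightarrow> dirichlet_char p chi \<longrightarrow> chi \<noteq> principal_char p \<longrightarrow>
           A > 0 \<longrightarrow> B > 0 \<longrightarrow> C > 0 \<longrightarrow> D > 0 \<longrightarrow> A * B * C < p \<longrightarrow> D < p \<longrightarrow>
           \<D> \<subseteq> {1..p - 1} \<longrightarrow> card \<D> = D \<longrightarrow> (\<forall>d\<in>\<D>. cmod (\<alpha> d) \<le> 1) \<longrightarrow>
           T_sum chi A B C \<D> \<alpha> \<le>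
             K * real (A * B * C * D) *
             ((real p / real (A * B * C)) powr (1 / (2 * real \<nu>)) * real D powr (- 1 / 2)
              + (real p powr (1 / 2) / real (A * B * C)) powr (1 / (2 * real \<nu>)))
             * ln (real p) powr (4 / real \<nu>)"
proof (intro exI[of _ "64 * (real (\<nu> ^ (2 * \<nu>)) + real (2 * \<nu>))"] allI impI)
  fix p A B C D :: nat and chi :: "int \<Rightarrow> complex" and \<D> :: "nat set" and \<alpha> :: "nat \<Rightarrow> complex"
  assume p: "prime p" and chi: "dirichlet_char p chi" "chi \<noteq> principal_char p"
    and pos: "A > 0" "B > 0" "C > 0" "D > 0" and ABC: "A * B * C < p"
    and \<D>: "\<D> \<subseteq> {1..p - 1}" "card \<D> = D" and \<alpha>: "\<forall>d\<in>\<D>. cmod (\<alpha> d) \<le> 1"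
  obtain n where n: "\<nu> = Suc n" using assms by (cases \<nu>) auto
  have p3: "p \<ge> 3" by (rule nonprincipal_imp_prime_ge_3[OF p chi])
  have "exp 1 \<le> real p" using exp_le p3 by linarith
  hence L: "ln (real p) \<ge> 1" using p3 by (subst ln_ge_iff) auto
  have \<D>': "\<D> \<subseteq> {..<p}" using \<D>(1) p3 by fastforce
  have "T_sum chi A B C \<D> \<alpha> \<le> 64 * (real (\<nu> ^ (2 * \<nu>)) + real (2 * \<nu>)) * (real (A * B * C) * real D) *
      ((real p / real (A * B * C)) powr (1 / (2 * real \<nu>)) * real D powr (- 1 / 2)
        + (real p powr (1 / 2) / real (A * B * C)) powr (1 / (2 * real \<nu>)))
      * ln (real p) powr (4 / real \<nu>)"
    unfolding n
  proof (rule le_of_power_bound[OF _ _ _ L _ _ refl])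
    show "T_sum chi A B C \<D> \<alpha> ^ (2 * Suc n) \<le> real (A * B * C) ^ (2 * n)
        * (real (A * B * C) * (2 * ln (real p)) ^ 6)
        * (real (Suc n ^ (2 * Suc n)) * real p * real D ^ Suc n
          + real (2 * Suc n) * sqrt (real p) * real D ^ (2 * Suc n))"
      using T_sum_power_bound[OF p chi ABC pos(1-3) \<D>', of \<alpha> n] \<alpha> \<D>(2) by simp
    have "1 \<le> A * B * C" using pos by (simp add: Suc_le_eq)
    thus "1 \<le> real (A * B * C)" using of_nat_mono[of 1 "A * B * C", where ?'a = real] by simp
    show "1 \<le> real (Suc n ^ (2 * Suc n))" by (simp only: of_nat_power) (rule one_le_power, simp)
  qed (use pos p3 in auto)
  thus "T_sum chi A B C \<D> \<alpha> \<le> 64 * (real (\<nu> ^ (2 * \<nu>)) + real (2 * \<nu>)) * real (A * B * C * D) *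
      ((real p / real (A * B * C)) powr (1 / (2 * real \<nu>)) * real D powr (- 1 / 2)
        + (real p powr (1 / 2) / real (A * B * C)) powr (1 / (2 * real \<nu>)))
      * ln (real p) powr (4 / real \<nu>)"
    by (simp only: of_nat_mult)
qed

end
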